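(* Let $L_p/\mathbb{Q}_p$ be a finite extension with ring of integers $O$, unit group $O^\times$, uniformizer $\pi$ and residue field of order $q$. Fix an integer $n\ge1$ and let $\epsilon>0$ satisfy $|\pi^{n+1}|<\epsilon\le|\pi^n|$. Let \[ F'=\{\zeta\in\mathsf{P}^1(\mathbb{C}_p) : \zeta=\zeta_{x,\eta}\text{ for some }x\in O^\times,\ 0\le\eta\le\epsilon\}. \] Then the $\delta$-Robin constant of $F'$ satisfies \[ V_\delta(F')\ge V_\delta(O^\times)+\frac{(q-2)\log|\pi|}{q^{n-1}(q-1)^2} = -\Big(1-\frac{q-2}{q^n}\Big)\frac{q\log|\pi|}{(q-1)^2}. \]
   Context: $|\cdot|$ is the absolute value on $\mathbb{C}_p$ with $|p|=1/p$, and $\mathsf{P}^1(\mathbb{C}_p)$ is the Berkovich projective line. For $x\in\mathbb{C}_p$ and $\eta>0$, $\zeta_{x,\eta}$ is the point (of type II or III) corresponding to the closed disc $\{z:|z-x|\le\eta\}$, and $\zeta_{x,0}=x$. The kernel $\delta$ is the spherical kernel $\delta(x,y)=\frac{|x_0y_1-y_0x_1|}{\max\{|x_0|,|x_1|\}\max\{|y_0|,|y_1|\}}$ on $\mathbb{P}^1(\mathbb{C}_p)$, extended to $\mathsf{P}^1(\mathbb{C}_p)$ as the generalized Hsia kernel with respect to the Gauss point $\zeta_{0,1}$; in particular for $|a|,|b|\le1$, $r,s\le1$, $\delta(\zeta_{a,r},\zeta_{b,s})=\max\{|a-b|,r,s\}$. For a compact $E\subset\mathsf{P}^1(\mathbb{C}_p)$,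 $V_\delta(E)=\inf_\nu\iint -\log\delta\,d\nu\,d\nu$ over Borel probability measures $\nu$ supported on $E$.
   Formalization: The inequality is asserted only for q ≠ 2 (it fails for q = 2: for L_p = Q_2, n = 1, ε = 1/2 the point mass at ζ_{1,1/2} has energy log 2, less than the right side 2 log 2); the equality is asserted for every q. *)

theory Defs
  imports
    "HOL-Probability.Probability"
    "HOL-Computational_Algebra.Polynomial"
begin

section \<open>The field \<open>\<complex>\<^sub>p\<close> and finite extensions of \<open>\<rat>\<^sub>p\<close>\<close>

definition vtop :: "('k::field \<Rightarrow> real) \<Rightarrow> 'k topology" where
  "vtop vabs = Metric_space.mtopology UNIV (\<lambda>x y. vabs (x - y))"

text \<open>Inside a complete field whose absolute value restricts to the \<open>p\<close>-adic one on the
  rationals, \<open>\<rat>\<^sub>p\<close> is the closure of the rationals.\<close>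

definition Qp :: "('k::field_char_0 \<Rightarrow> real) \<Rightarrow> 'k set" where
  "Qp vabs = vtop vabs closure_of \<rat>"

definition algebraic_over :: "'k::field set \<Rightarrow> 'k \<Rightarrow> bool" where
  "algebraic_over F x \<longleftrightarrow> (\<exists>f. f \<noteq> 0 \<and> (\<forall>i. coeff f i \<in> F) \<and> poly f x = 0)"

text \<open>\<open>\<complex>\<^sub>p\<close> is the completion of an algebraic closure of \<open>\<rat>\<^sub>p\<close>. It is again algebraically
  closed, so an algebraic closure of \<open>\<rat>\<^sub>p\<close> is given by its elements algebraic over \<open>\<rat>\<^sub>p\<close>.
  The axioms below determine the valued field up to isometric isomorphism.\<close>

locale padic_complex_field =
  fixes p :: nat and vabs :: "'k::{alg_closed_field, field_char_0} \<Rightarrow> real"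
  assumes prime_p: "prime p"
    and vabs_nonneg: "vabs x \<ge> 0"
    and vabs_eq_0_iff: "vabs x = 0 \<longleftrightarrow> x = 0"
    and vabs_mult: "vabs (x * y) = vabs x * vabs y"
    and vabs_add_le_max: "vabs (x + y) \<le> max (vabs x) (vabs y)"
    and vabs_p: "vabs (of_nat p) = 1 / real p"
    and complete: "Metric_space.mcomplete UNIV (\<lambda>x y. vabs (x - y))"
    and algebraic_dense: "vtop vabs closure_of {x. algebraic_over (Qp vabs) x} = UNIV"

definition is_subfield :: "'k::field set \<Rightarrow> bool" where
  "is_subfield F \<longleftrightarrow> 0 \<in> F \<and> 1 \<in> F \<and>
     (\<forall>x\<in>F. \<forall>y\<in>F. x + y \<in> F \<and> x * y \<in> F) \<and> (\<forall>x\<in>F. - x \<in> F \<and> inverse x \<in> F)"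

definition finite_extension_Qp :: "('k::field_char_0 \<Rightarrow> real) \<Rightarrow> 'k set \<Rightarrow> bool" where
  "finite_extension_Qp vabs L \<longleftrightarrow> is_subfield L \<and> Qp vabs \<subseteq> L \<and>
     (\<exists>B. finite B \<and> B \<subseteq> L \<and> (\<forall>x\<in>L. \<exists>c. (\<forall>b\<in>B. c b \<in> Qp vabs) \<and> x = (\<Sum>b\<in>B. c b * b)))"

definition integer_ring :: "('k::field \<Rightarrow> real) \<Rightarrow> 'k set \<Rightarrow> 'k set" where
  "integer_ring vabs L = {x \<in> L. vabs x \<le> 1}"

definition unit_group :: "('k::field \<Rightarrow> real) \<Rightarrow> 'k set \<Rightarrow> 'k set" where
  "unit_group vabs L = {x \<in> integer_ring vabs L. \<exists>y\<in>integer_ring vabs L. x * y = 1}"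

definition maximal_ideal :: "('k::field \<Rightarrow> real) \<Rightarrow> 'k set \<Rightarrow> 'k set" where
  "maximal_ideal vabs L = {x \<in> L. vabs x < 1}"

definition uniformizer :: "('k::field \<Rightarrow> real) \<Rightarrow> 'k set \<Rightarrow> 'k \<Rightarrow> bool" where
  "uniformizer vabs L \<pi> \<longleftrightarrow> \<pi> \<in> L \<and> maximal_ideal vabs L = (\<lambda>y. \<pi> * y) ` integer_ring vabs L"

definition residue_field_order :: "('k::field \<Rightarrow> real) \<Rightarrow> 'k set \<Rightarrow> nat" where
  "residue_field_order vabs L =
     card (integer_ring vabs L //
       {(x, y) \<in> integer_ring vabs L \<times> integer_ring vabs L. x - y \<in> maximal_ideal vabs L})"


section \<open>The Berkovich projective line\<close>

text \<open>Points of the Berkovich affine line are the multiplicative seminorms on the polynomial ring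
  that extend the absolute value, with the topology of pointwise convergence; the projective line
  is its one-point compactification, so \<open>None\<close> is the point at infinity.\<close>

type_synonym 'k berk = "('k poly \<Rightarrow> real) option"

definition mult_seminorms :: "('k::field \<Rightarrow> real) \<Rightarrow> ('k poly \<Rightarrow> real) set" where
  "mult_seminorms vabs = {\<nu>. (\<forall>f. 0 \<le> \<nu> f) \<and> (\<forall>f g. \<nu> (f * g) = \<nu> f * \<nu> g) \<and>
     (\<forall>f g. \<nu> (f + g) \<le> \<nu> f + \<nu> g) \<and> (\<forall>c. \<nu> [:c:] = vabs c)}"

definition berk_P1 :: "('k::field \<Rightarrow> real) \<Rightarrow> 'k berk topology" where
  "berk_P1 vabs =
     Alexandroff_compactification (subtopology (powertop_real UNIV) (mult_seminorms vabs))"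

text \<open>The point \<open>\<zeta>\<^bsub>x,\<eta>\<^esub>\<close> is the supremum seminorm of the closed disc. For \<open>\<eta> = 0\<close> it is
  evaluation at \<open>x\<close>, the type I point usually identified with \<open>x\<close>.\<close>

definition disc_norm :: "('k::field \<Rightarrow> real) \<Rightarrow> 'k \<Rightarrow> real \<Rightarrow> 'k poly \<Rightarrow> real" where
  "disc_norm vabs x \<eta> f = (SUP z\<in>{z. vabs (z - x) \<le> \<eta>}. vabs (poly f z))"

definition disc_point :: "('k::field \<Rightarrow> real) \<Rightarrow> 'k \<Rightarrow> real \<Rightarrow> 'k berk" where
  "disc_point vabs x \<eta> = Some (disc_norm vabs x \<eta>)"


section \<open>The generalized Hsia kernel with respect to the Gauss point\<close>

text \<open>The pair \<open>(d, f)\<close> with \<open>degree f \<le> d\<close> stands for the form \<open>Y\<^sup>d f(X/Y)\<close> of degree \<open>d\<close>; its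
  value at a point is taken for the normalization in which \<open>max [X] [Y] = 1\<close>.\<close>

definition form_norm :: "('k::field \<Rightarrow> real) \<Rightarrow> 'k berk \<Rightarrow> nat \<Rightarrow> 'k poly \<Rightarrow> real" where
  "form_norm vabs \<zeta> d f =
     (case \<zeta> of None \<Rightarrow> vabs (coeff f d) | Some \<nu> \<Rightarrow> \<nu> f / (max 1 (\<nu> [:0, 1:])) ^ d)"

text \<open>The tree order with the Gauss point as root: \<open>\<zeta> \<preceq> \<xi>\<close> iff \<open>\<xi>\<close> lies on the path from \<open>\<zeta>\<close> to
  the Gauss point. On the closed unit disc \<open>[T] \<le> 1\<close> this is the order
  \<open>\<forall>f. [f]\<^bsub>\<zeta>\<^esub> \<le> [f]\<^bsub>\<xi>\<^esub>\<close>; forms make it invariant under \<open>T \<mapsto> 1/T\<close>.\<close>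

definition gauss_le :: "('k::field \<Rightarrow> real) \<Rightarrow> 'k berk \<Rightarrow> 'k berk \<Rightarrow> bool" where
  "gauss_le vabs \<zeta> \<xi> \<longleftrightarrow> (\<forall>d f. degree f \<le> d \<longrightarrow> form_norm vabs \<zeta> d f \<le> form_norm vabs \<xi> d f)"

text \<open>The least upper bound is the point where the paths from \<open>\<zeta>\<close> and \<open>\<xi>\<close> to the Gauss point
  first meet.\<close>

definition gauss_join :: "('k::field \<Rightarrow> real) \<Rightarrow> 'k berk \<Rightarrow> 'k berk \<Rightarrow> 'k berk" where
  "gauss_join vabs \<zeta> \<xi> = (THE \<omega>. \<omega> \<in> topspace (berk_P1 vabs) \<and>
     gauss_le vabs \<zeta> \<omega> \<and> gauss_le vabs \<xi> \<omega> \<and>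
     (\<forall>\<theta> \<in> topspace (berk_P1 vabs). gauss_le vabs \<zeta> \<theta> \<longrightarrow> gauss_le vabs \<xi> \<theta> \<longrightarrow> gauss_le vabs \<omega> \<theta>))"

text \<open>The diameter with respect to the Gauss point, i.e. \<open>exp\<close> of minus the path distance to it:
  the infimum of the values of the linear forms \<open>aX + bY\<close> with \<open>max |a| |b| = 1\<close>.
  On \<open>[T] \<le> 1\<close> it is the radius \<open>inf\<^sub>c [T - c]\<close>.\<close>

definition gauss_diam :: "('k::field \<Rightarrow> real) \<Rightarrow> 'k berk \<Rightarrow> real" where
  "gauss_diam vabs \<zeta> = Inf {form_norm vabs \<zeta> 1 [:b, a:] |a b. max (vabs a) (vabs b) = 1}"

text \<open>The kernel is the diameter of the join. It extends the spherical kernel on type I points; its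
  values on discs inside the closed unit disc are computed in \<open>hsia_disc_points\<close> below.\<close>

definition hsia :: "('k::field \<Rightarrow> real) \<Rightarrow> 'k berk \<Rightarrow> 'k berk \<Rightarrow> real" where
  "hsia vabs \<zeta> \<xi> = gauss_diam vabs (gauss_join vabs \<zeta> \<xi>)"

context padic_complex_field
begin

lemma vabs_0: "vabs 0 = 0" by (simp add: vabs_eq_0_iff)

lemma vabs_1: "vabs 1 = 1"
proof -
  have "vabs 1 * vabs 1 = vabs 1" using vabs_mult[of 1 1] by simp
  moreover have "vabs 1 \<noteq> 0" by (simp add: vabs_eq_0_iff)
  ultimately show ?thesis by simp
qed

lemma vabs_minus: "vabs (- x) = vabs x"
proof -
  have "vabs (-1) * vabs (-1) = 1" using vabs_mult[of "-1" "-1"] by (simp add: vabs_1)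
  hence "vabs (-1) = 1" using vabs_nonneg[of "-1"]
    by (metis abs_of_nonneg real_sqrt_one real_sqrt_abs2)
  thus ?thesis using vabs_mult[of "-1" x] by simp
qed

lemma vabs_minus_commute: "vabs (x - y) = vabs (y - x)"
  using vabs_minus[of "x - y"] by simp

lemma vabs_diff_le_max: "vabs (x - z) \<le> max (vabs (x - y)) (vabs (y - z))"
  using vabs_add_le_max[of "x - y" "y - z"] by simp

lemma vabs_diff_eq_max:
  assumes "vabs (x - y) \<noteq> vabs (y - z)"
  shows "vabs (x - z) = max (vabs (x - y)) (vabs (y - z))"
  using vabs_diff_le_max[of x z y] vabs_diff_le_max[of x y z] vabs_diff_le_max[of y z x] assms
    vabs_minus_commute[of y x] vabs_minus_commute[of z y]
  by (auto simp: max_def split: if_splits)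

lemma vabs_power: "vabs (x ^ n) = vabs x ^ n"
  by (induction n) (simp_all add: vabs_1 vabs_mult)

lemma vabs_inverse: "vabs (inverse x) = inverse (vabs x)"
proof (cases "x = 0")
  case False
  hence "vabs x * vabs (inverse x) = 1" using vabs_mult[of x "inverse x"] by (simp add: vabs_1)
  thus ?thesis by (metis inverse_unique)
qed (simp add: vabs_0)

lemma vabs_values_dense:
  assumes "0 \<le> s" "s < t"
  obtains z where "s < vabs z" "vabs z < t"
proof -
  define P where "P = real p"
  have P: "P > 1" using prime_gt_1_nat[OF prime_p] by (simp add: P_def)
  define s' where "s' = (s + t) / 2"
  have s': "0 < s'" "s < s'" "s' < t" using assms by (auto simp: s'_def)
  have "log P s' < log P t" using s' P by simp
  then obtain y :: rat where y: "log P s' < of_rat y" "of_rat y < log P t"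
    using of_rat_dense by blast
  obtain a b where ab: "y = Fract a b" "b > 0" by (cases y) auto
  define w :: 'k where "w = (if a \<ge> 0 then inverse (of_nat p ^ nat a) else of_nat p ^ nat (- a))"
  have w: "vabs w = P powr a"
  proof (cases "a \<ge> 0")
    case True
    hence "vabs w = P ^ nat a"
      by (simp add: w_def vabs_inverse vabs_power vabs_p P_def power_divide)
    also have "\<dots> = P powr a" using True P by (simp flip: powr_realpow)
    finally show ?thesis .
  next
    case False
    hence "vabs w = inverse (P ^ nat (- a))"
      by (simp add: w_def vabs_power vabs_p P_def power_divide inverse_eq_divide)
    also have "\<dots> = P powr a" using False P by (simp add: powr_minus flip: powr_realpow)
    finally show ?thesis .
  qed
  define k where "k = nat b"
  have k: "k > 0" "real k = b" using ab by (auto simp: k_def)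
  obtain z where z: "z ^ k = w" using nth_root_exists[OF k(1), of w] by blast
  have "vabs z ^ k = P powr a" using z w by (metis vabs_power)
  moreover have "(P powr of_rat y) ^ k = P powr a"
    using k ab P by (simp add: powr_realpow[symmetric] powr_powr of_rat_rat)
  ultimately have "vabs z = P powr of_rat y"
    using k by (metis power_eq_imp_eq_base vabs_nonneg powr_ge_zero)
  moreover have "s' < P powr of_rat y" using y P s' by (simp add: log_less_iff)
  moreover have "P powr of_rat y < t" using y P s' by (simp add: less_log_iff)
  ultimately show ?thesis using that[of z] s' by auto
qed


abbreviation D :: "'k \<Rightarrow> real \<Rightarrow> 'k poly \<Rightarrow> real" where
  "D \<equiv> disc_norm vabs"

lemma vabs_poly_split:
  "vabs (poly (smult l (\<Prod>c\<in>#A. [:-c, 1:])) z) = vabs l * (\<Prod>c\<in>#A. vabs (z - c))"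
proof -
  have "vabs (poly (\<Prod>c\<in>#A. [:-c, 1:]) z) = (\<Prod>c\<in>#A. vabs (z - c))"
    by (induction A)
       (simp_all add: vabs_1 vabs_mult del: mult_pCons_left)
  thus ?thesis by (simp add: vabs_mult)
qed

lemma prod_mset_mono_real:
  fixes f g :: "'b \<Rightarrow> real"
  assumes "\<And>c. c \<in># A \<Longrightarrow> 0 \<le> f c \<and> f c \<le> g c"
  shows "0 \<le> (\<Prod>c\<in>#A. f c) \<and> (\<Prod>c\<in>#A. f c) \<le> (\<Prod>c\<in>#A. g c)"
  using assms
proof (induction A)
  case (add x A)
  hence "0 \<le> prod_mset (image_mset f A) \<and> prod_mset (image_mset f A) \<le> prod_mset (image_mset g A)"
    by simp
  moreover have "0 \<le> f x" "f x \<le> g x" using add.prems by auto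
  ultimately show ?case by (auto intro: mult_mono)
qed simp

lemma split_bound:
  assumes "vabs (z - a) \<le> r"
  shows "vabs (poly (smult l (\<Prod>c\<in>#A. [:-c, 1:])) z) \<le> vabs l * (\<Prod>c\<in>#A. max (vabs (a - c)) r)"
  unfolding vabs_poly_split
proof (intro mult_left_mono vabs_nonneg)
  have "0 \<le> vabs (z - c) \<and> vabs (z - c) \<le> max (vabs (a - c)) r" for c
    using vabs_diff_le_max[of z c a] assms vabs_nonneg[of "z - c"] by auto
  thus "(\<Prod>c\<in>#A. vabs (z - c)) \<le> (\<Prod>c\<in>#A. max (vabs (a - c)) r)"
    by (rule prod_mset_mono_real[THEN conjunct2])
qed

lemma D_split:
  assumes "0 \<le> r"
  shows "D a r (smult l (\<Prod>c\<in>#A. [:-c, 1:])) = vabs l * (\<Prod>c\<in>#A. max (vabs (a - c)) r)"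
    (is "D a r ?f = ?g r")
proof (rule antisym)
  have ne: "{z. vabs (z - a) \<le> r} \<noteq> {}" using assms by (auto intro!: exI[of _ a] simp: vabs_0)
  show "D a r ?f \<le> ?g r" unfolding disc_norm_def by (rule cSUP_least[OF ne]) (use split_bound in auto)
  have bdd: "bdd_above ((\<lambda>z. vabs (poly ?f z)) ` {z. vabs (z - a) \<le> r})"
    by (rule bdd_aboveI2[of _ _ "?g r"]) (use split_bound in auto)
  show "?g r \<le> D a r ?f"
  proof (cases "r = 0")
    case True
    have "?g r = vabs (poly ?f a)" unfolding vabs_poly_split using True
      by (simp add: max_absorb1 vabs_nonneg)
    thus ?thesis using cSUP_upper[OF _ bdd, of a] assms by (auto simp: vabs_0 disc_norm_def)
  next
    case False
    hence r: "r > 0" using assms by simp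
    have "?g s \<le> D a r ?f" if s: "0 < s" "s < r" for s
    proof -
      define S where "S = insert r {v \<in> (\<lambda>c. vabs (a - c)) ` set_mset A. v > s}"
      have fin: "finite S" "S \<noteq> {}" by (auto simp: S_def)
      have "s < Min S" using fin s by (auto simp: S_def)
      then obtain w where w: "s < vabs w" "vabs w < Min S"
        using vabs_values_dense[of s "Min S"] s by auto
      have wS: "vabs w < v" if "v \<in> S" for v using w(2) fin that by auto
      have wr: "vabs w \<le> r" using wS[of r] by (auto simp: S_def)
      have "max (vabs (a - c)) s \<le> vabs (a + w - c)" if "c \<in># A" for c
      proof -
        have "vabs w \<noteq> vabs (a - c)"
          using wS[of "vabs (a - c)"] w(1) that by (auto simp: S_def)
        thus ?thesis using vabs_diff_eq_max[of "a + w" a c] w(1) by auto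
      qed
      hence "(\<Prod>c\<in>#A. max (vabs (a - c)) s) \<le> (\<Prod>c\<in>#A. vabs (a + w - c))"
        using s by (intro prod_mset_mono_real[THEN conjunct2]) (auto simp: le_max_iff_disj)
      hence "?g s \<le> vabs (poly ?f (a + w))"
        unfolding vabs_poly_split by (intro mult_left_mono vabs_nonneg)
      also have "\<dots> \<le> D a r ?f" unfolding disc_norm_def by (rule cSUP_upper[OF _ bdd]) (use wr in auto)
      finally show ?thesis .
    qed
    hence "eventually (\<lambda>s. ?g s \<le> D a r ?f) (at_left r)"
      using r eventually_at_left_real[of 0 r] by (auto elim!: eventually_mono)
    moreover have "(?g \<longlongrightarrow> ?g r) (at_left r)"
    proof (intro tendsto_intros)
      show "((\<lambda>s. \<Prod>c\<in>#A. max (vabs (a - c)) s) \<longlongrightarrow> (\<Prod>c\<in>#A. max (vabs (a - c)) r)) (at_left r)"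
        by (induction A) (auto intro!: tendsto_intros)
    qed
    ultimately show ?thesis by (intro tendsto_upperbound) auto
  qed
qed

lemma poly_split:
  obtains l A where "(f :: 'k poly) = smult l (\<Prod>c\<in>#A. [:-c, 1:])"
proof (cases "f = 0")
  case True thus ?thesis using that[of 0 "{#}"] by simp
next
  case False thus ?thesis using alg_closed_imp_factorization[OF False] that by blast
qed

lemma D_linear:
  assumes "0 \<le> r"
  shows "D a r [:-c, 1:] = max (vabs (a - c)) r"
  using D_split[OF assms, of a 1 "{#c#}"] by (simp add: vabs_1)

lemma D_const: "0 \<le> r \<Longrightarrow> D a r [:c:] = vabs c"
  using D_split[of r a c "{#}"] by simp

lemma D_smult: "0 \<le> r \<Longrightarrow> D a r (smult c f) = vabs c * D a r f"
proof -
  assume r: "0 \<le> r"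
  obtain l A where f: "f = smult l (\<Prod>c\<in>#A. [:-c, 1:])" by (rule poly_split)
  show ?thesis unfolding f smult_smult D_split[OF r] by (simp add: vabs_mult)
qed

lemma D_mult: "0 \<le> r \<Longrightarrow> D a r (f * g) = D a r f * D a r g"
proof -
  assume r: "0 \<le> r"
  obtain l A where f: "f = smult l (\<Prod>c\<in>#A. [:-c, 1:])" by (rule poly_split)
  obtain m B where g: "g = smult m (\<Prod>c\<in>#B. [:-c, 1:])" by (rule poly_split)
  have "f * g = smult (l * m) (\<Prod>c\<in>#A + B. [:-c, 1:])" by (simp add: f g mult.commute)
  thus ?thesis unfolding f g by (simp only: D_split[OF r]) (simp add: vabs_mult)
qed

lemma D_upper:
  assumes "vabs (z - a) \<le> r"
  shows "vabs (poly f z) \<le> D a r f"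
proof -
  obtain l A where f: "f = smult l (\<Prod>c\<in>#A. [:-c, 1:])" by (rule poly_split)
  have "0 \<le> r" using assms vabs_nonneg[of "z - a"] by linarith
  thus ?thesis using split_bound[OF assms, of l A] unfolding f by (simp only: D_split)
qed

lemma disc_point_in_P1:
  assumes "0 \<le> r"
  shows "disc_point vabs a r \<in> topspace (berk_P1 vabs)"
proof -
  have a: "vabs (a - a) \<le> r" using assms by (simp add: vabs_0)
  have nn: "0 \<le> D a r f" for f
    using D_upper[OF a, of f] vabs_nonneg[of "poly f a"] by linarith
  have "D a r (f + g) \<le> D a r f + D a r g" for f g
    unfolding disc_norm_def[of _ _ _ "f + g"]
  proof (rule cSUP_least)
    show "{z. vabs (z - a) \<le> r} \<noteq> {}" using a by blast
    fix z assume "z \<in> {z. vabs (z - a) \<le> r}"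
    hence z: "vabs (z - a) \<le> r" by simp
    show "vabs (poly (f + g) z) \<le> D a r f + D a r g"
      using vabs_add_le_max[of "poly f z" "poly g z"] D_upper[OF z, of f] D_upper[OF z, of g]
        nn[of f] nn[of g] unfolding poly_add by linarith
  qed
  hence "D a r \<in> mult_seminorms vabs"
    unfolding mult_seminorms_def using nn D_mult[OF assms] D_const[OF assms] by blast
  thus ?thesis by (simp add: berk_P1_def disc_point_def)
qed

lemma form_norm_disc_point:
  assumes "vabs a \<le> 1" "0 \<le> r" "r \<le> 1"
  shows "form_norm vabs (disc_point vabs a r) d f = D a r f"
proof -
  have "D a r [:0, 1:] \<le> 1" using D_linear[OF assms(2), of a 0] assms by simp
  thus ?thesis by (simp add: form_norm_def disc_point_def max_absorb1)
qed

lemma gauss_le_antisym: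
  assumes "\<zeta> \<in> topspace (berk_P1 vabs)" "\<xi> \<in> topspace (berk_P1 vabs)"
    and "gauss_le vabs \<zeta> \<xi>" "gauss_le vabs \<xi> \<zeta>"
  shows "\<zeta> = \<xi>"
proof -
  have eq: "form_norm vabs \<zeta> d f = form_norm vabs \<xi> d f" if "degree f \<le> d" for d f
    using assms(3,4) that unfolding gauss_le_def by (meson antisym)
  have one: "\<nu> [:1:] = 1" if "Some \<nu> \<in> topspace (berk_P1 vabs)" for \<nu>
    using that by (auto simp: berk_P1_def mult_seminorms_def vabs_1)
  show ?thesis
  proof (cases \<zeta>; cases \<xi>)
    fix \<nu> \<mu> assume z: "\<zeta> = Some \<nu>" and x: "\<xi> = Some \<mu>"
    have m: "max 1 (\<nu> [:0, 1:]) = max 1 (\<mu> [:0, 1:])"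
      using eq[of "[:1:]" 1] one[of \<nu>] one[of \<mu>] assms(1,2) by (simp add: form_norm_def z x)
    have "\<nu> f = \<mu> f" for f
      using eq[of f "degree f"] max.cobounded1[of 1 "\<mu> [:0, 1:]"]
      by (auto simp: form_norm_def z x m simp del: max.cobounded1)
    thus ?thesis by (auto simp: z x)
  next
    fix \<nu> assume "\<zeta> = Some \<nu>" "\<xi> = None"
    thus ?thesis using eq[of "[:1:]" 1] one[of \<nu>] assms(1) by (auto simp: form_norm_def vabs_0 max_def split: if_splits)
  next
    fix \<mu> assume "\<zeta> = None" "\<xi> = Some \<mu>"
    thus ?thesis using eq[of "[:1:]" 1] one[of \<mu>] assms(2) by (auto simp: form_norm_def vabs_0 max_def split: if_splits)
  qed simp
qed

lemma seminorm_split: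
  assumes "\<nu> \<in> mult_seminorms vabs"
  shows "\<nu> (smult l (\<Prod>c\<in>#A. [:-c, 1:])) = vabs l * (\<Prod>c\<in>#A. \<nu> [:-c, 1:])"
proof -
  have m: "\<nu> (f * g) = \<nu> f * \<nu> g" and c: "\<nu> [:c:] = vabs c" for f g c
    using assms by (auto simp: mult_seminorms_def)
  have "\<nu> (\<Prod>c\<in>#A. [:-c, 1:]) = (\<Prod>c\<in>#A. \<nu> [:-c, 1:])"
    by (induction A) (use c[of 1, folded one_pCons] in \<open>simp_all add: m vabs_1 del: mult_pCons_left\<close>)
  moreover have "\<nu> (smult l f) = vabs l * \<nu> f" for f using m[of "[:l:]" f] by (simp add: c)
  ultimately show ?thesis by simp
qed

lemma gauss_join_disc_points:
  assumes "vabs a \<le> 1" "vabs b \<le> 1" "0 \<le> r" "r \<le> 1" "0 \<le> s" "s \<le> 1"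
  defines "R \<equiv> max (vabs (a - b)) (max r s)"
  shows "gauss_join vabs (disc_point vabs a r) (disc_point vabs b s) = disc_point vabs a R"
proof -
  have R: "0 \<le> R" "R \<le> 1" "r \<le> R" "s \<le> R" "vabs (a - b) \<le> R"
    using assms vabs_add_le_max[of a "- b"] by (auto simp: R_def vabs_minus)
  note fn = form_norm_disc_point[OF assms(1,3,4)] form_norm_disc_point[OF assms(2,5,6)]
    form_norm_disc_point[OF assms(1) R(1,2)]
  have mono: "D x t f \<le> D a R f" if "0 \<le> t" "t \<le> R" "vabs (a - x) \<le> R" for x t f
    unfolding disc_norm_def[of _ x]
  proof (rule cSUP_least)
    show "{z. vabs (z - x) \<le> t} \<noteq> {}" using that by (auto intro!: exI[of _ x] simp: vabs_0)
    fix z assume "z \<in> {z. vabs (z - x) \<le> t}"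
    thus "vabs (poly f z) \<le> D a R f"
      using that vabs_diff_le_max[of z a x] vabs_minus_commute[of a x] by (intro D_upper) auto
  qed
  let ?\<omega> = "disc_point vabs a R"
  let ?P = "\<lambda>\<omega>. \<omega> \<in> topspace (berk_P1 vabs) \<and>
     gauss_le vabs (disc_point vabs a r) \<omega> \<and> gauss_le vabs (disc_point vabs b s) \<omega> \<and>
     (\<forall>\<theta> \<in> topspace (berk_P1 vabs). gauss_le vabs (disc_point vabs a r) \<theta> \<longrightarrow>
        gauss_le vabs (disc_point vabs b s) \<theta> \<longrightarrow> gauss_le vabs \<omega> \<theta>)"
  have least: "gauss_le vabs ?\<omega> \<theta>"
    if \<theta>: "\<theta> \<in> topspace (berk_P1 vabs)" and 1: "gauss_le vabs (disc_point vabs a r) \<theta>"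
      and 2: "gauss_le vabs (disc_point vabs b s) \<theta>" for \<theta>
  proof -
    have ge: "D a r f \<le> form_norm vabs \<theta> d f" "D b s f \<le> form_norm vabs \<theta> d f"
      if "degree f \<le> d" for d f
      using 1 2 that unfolding gauss_le_def fn by auto
    have one: "1 \<le> form_norm vabs \<theta> 1 [:1:]"
      using ge(1)[of "[:1:]" 1] D_const[OF assms(3), of a 1] by (simp add: vabs_1)
    then obtain \<nu> where \<nu>: "\<theta> = Some \<nu>" "\<nu> \<in> mult_seminorms vabs"
      using \<theta> by (cases \<theta>) (auto simp: form_norm_def vabs_0 berk_P1_def)
    have "\<nu> [:1:] = 1" using \<nu> by (simp add: mult_seminorms_def vabs_1)
    hence "max 1 (\<nu> [:0, 1:]) = 1"
      using one by (simp add: form_norm_def \<nu> pos_le_divide_eq split: if_splits)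
    hence fn\<theta>: "form_norm vabs \<theta> d f = \<nu> f" for d f by (simp add: form_norm_def \<nu>)
    have lin: "max (vabs (a - c)) R \<le> \<nu> [:-c, 1:]" for c
      using ge(1)[of "[:-c, 1:]" 1] ge(2)[of "[:-c, 1:]" 1] D_linear[OF assms(3), of a c]
        D_linear[OF assms(5), of b c] vabs_diff_le_max[of a b c] vabs_minus_commute[of b c]
      by (auto simp: fn\<theta> R_def)
    have "D a R f \<le> \<nu> f" for f
    proof -
      obtain l A where f: "f = smult l (\<Prod>c\<in>#A. [:-c, 1:])" by (rule poly_split)
      have "(\<Prod>c\<in>#A. max (vabs (a - c)) R) \<le> (\<Prod>c\<in>#A. \<nu> [:-c, 1:])"
        using lin R(1) by (intro prod_mset_mono_real[THEN conjunct2]) (auto simp: le_max_iff_disj)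
      thus ?thesis unfolding f D_split[OF R(1)] seminorm_split[OF \<nu>(2)]
        by (intro mult_left_mono vabs_nonneg)
    qed
    thus ?thesis by (simp add: gauss_le_def fn fn\<theta>)
  qed
  have P: "?P ?\<omega>"
    using least disc_point_in_P1[OF R(1), of a] mono[of r a] mono[of s b] R assms(3,5)
    by (auto simp: gauss_le_def fn vabs_0)
  show ?thesis unfolding gauss_join_def
  proof (rule the_equality)
    show "?P ?\<omega>" by (rule P)
    fix \<omega> assume "?P \<omega>"
    thus "\<omega> = ?\<omega>" using P by (intro gauss_le_antisym) blast+
  qed
qed

lemma gauss_diam_disc_point:
  assumes "vabs a \<le> 1" "0 \<le> r" "r \<le> 1"
  shows "gauss_diam vabs (disc_point vabs a r) = r"
  unfolding gauss_diam_def form_norm_disc_point[OF assms]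
proof (rule cInf_eq_minimum)
  show "r \<in> {D a r [:b, m:] |m b. max (vabs m) (vabs b) = 1}"
  proof (intro CollectI exI conjI)
    show "r = D a r [:- a, 1:]" unfolding D_linear[OF assms(2)] using assms by (simp add: vabs_0)
    show "max (vabs 1) (vabs (- a)) = 1" using assms by (simp add: vabs_1 vabs_minus)
  qed
  fix v assume "v \<in> {D a r [:b, m:] |m b. max (vabs m) (vabs b) = 1}"
  then obtain m b where v: "v = D a r [:b, m:]" and mb: "max (vabs m) (vabs b) = 1" by blast
  show "r \<le> v"
  proof (cases "vabs m = 1")
    case True
    hence m: "m \<noteq> 0" by (auto simp: vabs_0)
    have "[:b, m:] = smult m [:- (- b / m), 1:]" using m by simp
    hence "v = vabs m * max (vabs (a - (- b / m))) r"
      unfolding v by (simp only: D_smult[OF assms(2)] D_linear[OF assms(2)])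
    thus ?thesis using True by simp
  next
    case False
    hence b: "vabs b = 1" and m: "vabs m < 1" using mb by (auto simp: max_def split: if_splits)
    have "vabs (m * a) < 1" using m assms vabs_nonneg[of m] vabs_nonneg[of a]
      by (metis mult_left_le order_le_less_trans vabs_mult)
    hence "vabs (b + a * m) = 1"
      using vabs_diff_eq_max[of b 0 "- (a * m)"] b by (simp add: vabs_minus mult.commute)
    moreover have "vabs (poly [:b, m:] a) \<le> v"
      unfolding v by (rule D_upper) (use assms in \<open>simp add: vabs_0\<close>)
    ultimately show ?thesis using assms by simp
  qed
qed

lemma hsia_disc_points:
  assumes "vabs a \<le> 1" "vabs b \<le> 1" "0 \<le> r" "r \<le> 1" "0 \<le> s" "s \<le> 1"
  shows "hsia vabs (disc_point vabs a r) (disc_point vabs b s) = max (vabs (a - b)) (max r s)"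
  unfolding hsia_def gauss_join_disc_points[OF assms]
  using assms vabs_add_le_max[of a "- b"]
  by (intro gauss_diam_disc_point) (auto simp: vabs_minus)

end


section \<open>Robin constants\<close>

definition berk_borel :: "('k::field \<Rightarrow> real) \<Rightarrow> 'k berk measure" where
  "berk_borel vabs = sigma (topspace (berk_P1 vabs)) {U. openin (berk_P1 vabs) U}"

text \<open>The kernel takes values in \<open>[0,1]\<close>, so \<open>-log \<delta>\<close> takes values in \<open>[0,\<infinity>]\<close> and
  \<^const>\<open>ennreal\<close> truncates nothing.\<close>

definition neg_log :: "real \<Rightarrow> ennreal" where
  "neg_log t = (if t = 0 then \<infinity> else ennreal (- ln t))"

definition energy :: "('k::field \<Rightarrow> real) \<Rightarrow> 'k berk measure \<Rightarrow> ennreal" where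
  "energy vabs \<nu> = (\<integral>\<^sup>+ \<zeta>. (\<integral>\<^sup>+ \<xi>. neg_log (hsia vabs \<zeta> \<xi>) \<partial>\<nu>) \<partial>\<nu>)"

definition prob_measures_on :: "('k::field \<Rightarrow> real) \<Rightarrow> 'k berk set \<Rightarrow> 'k berk measure set" where
  "prob_measures_on vabs E =
     {\<nu>. prob_space \<nu> \<and> sets \<nu> = sets (berk_borel vabs) \<and> (AE \<zeta> in \<nu>. \<zeta> \<in> E)}"

definition robin :: "('k::field \<Rightarrow> real) \<Rightarrow> 'k berk set \<Rightarrow> ereal" where
  "robin vabs E = (INF \<nu>\<in>prob_measures_on vabs E. enn2ereal (energy vabs \<nu>))"

end

theory Submission
  imports Defs
begin

text \<open>Two units of \<open>L\<close> agree modulo \<open>\<pi>\<^sup>k\<^sup>+\<^sup>1\<close> iff they lie in the same of the \<open>(q - 1) q\<^sup>k\<close> residue classes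
  of level \<open>k\<close>, and \<open>-log \<delta>\<close> of two units is \<open>-log |\<pi>|\<close> times the number of levels at which their
  classes coincide. For discs of radius at most \<open>|\<pi>\<^sup>N|\<close> about units this remains a lower bound when
  only the levels \<open>k < N\<close> are counted. By Cauchy--Schwarz two independent random points share a
  class of level \<open>k\<close> with probability at least \<open>1 / ((q - 1) q\<^sup>k)\<close>, with equality for the Haar
  measure. Summing over all \<open>k\<close> gives \<open>V(O\<^sup>\<times>) = -q log |\<pi>| / (q - 1)\<^sup>2\<close>, and summing over
  \<open>k < n\<close> gives \<open>V(F') \<ge> (1 - q\<^sup>-\<^sup>n) V(O\<^sup>\<times>)\<close>, which is stronger than the claim as soon as
  \<open>q \<ge> 3\<close>.\<close>

subsection \<open>Absolute values and \<open>\<rat>\<^sub>p\<close>\<close>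

text \<open>Two obstacles shape the proof. The first is that \<open>L\<close> is merely a set,
  finitely generated over the closure of the rationals, with a generator \<open>\<pi>\<close> of its
  maximal ideal. Finiteness of the residue field has to be extracted from this finite generation,
  and closedness of the integer ring from that finiteness together with
  \<open>Qp vabs \<subseteq> L\<close>. The second is measurability: neither
  \<open>-log \<delta>\<close> nor the set of unit points is shown to be Borel. Integrals are
  therefore compared by monotonicity of \<open>nn_integral\<close>, which asks no measurability,
  with sums of indicators of open Berkovich discs, and almost sure statements pass through a Borel
  subset of the target. The Haar measure is built as the law of a random expansion with independent
  uniform digits.\<close>

context padic_complex_field
begin

lemma vabs_sum_le:
  assumes "0 \<le> c" "\<And>i. i \<in> A \<Longrightarrow> vabs (f i) \<le> c"
  shows "vabs (\<Sum>i\<in>A. f i) \<le> c"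
  using assms(2)
proof (induction A rule: infinite_finite_induct)
  case (insert i A)
  thus ?case using order_trans[OF vabs_add_le_max[of "f i" "sum f A"]] by simp
qed (use assms in \<open>auto simp: vabs_0\<close>)

lemma vabs_sum_less:
  assumes "0 < c" "\<And>i. i \<in> A \<Longrightarrow> vabs (f i) < c"
  shows "vabs (\<Sum>i\<in>A. f i) < c"
  using assms(2)
proof (induction A rule: infinite_finite_induct)
  case (insert i A)
  thus ?case using vabs_add_le_max[of "f i" "sum f A"] by (auto simp: le_less_trans)
qed (use assms in \<open>auto simp: vabs_0\<close>)

lemma vabs_mult_less_1: "vabs x \<le> 1 \<Longrightarrow> vabs y < 1 \<Longrightarrow> vabs (x * y) < 1"
  using mult_left_le_one_le[OF vabs_nonneg vabs_nonneg, of x y] by (simp add: vabs_mult)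

lemma vabs_add_less: "vabs x < c \<Longrightarrow> vabs y < c \<Longrightarrow> vabs (x + y) < c"
  using vabs_add_le_max[of x y] by auto

lemma vabs_diff_less: "vabs x < c \<Longrightarrow> vabs y < c \<Longrightarrow> vabs (x - y) < c"
  using vabs_add_less[of x c "- y"] by (simp add: vabs_minus)

lemma Metric_space_vabs: "Metric_space UNIV (\<lambda>x y. vabs (x - y))"
proof
  show "vabs (x - z) \<le> vabs (x - y) + vabs (y - z)" for x y z
    using vabs_diff_le_max[of x z y] vabs_nonneg[of "x - y"] vabs_nonneg[of "y - z"] by linarith
qed (auto simp: vabs_nonneg vabs_eq_0_iff vabs_minus_commute)

lemma mem_Qp_iff: "x \<in> Qp vabs \<longleftrightarrow> (\<forall>e>0. \<exists>r\<in>\<rat>. vabs (x - r) < e)"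
proof -
  interpret Metric_space UNIV "\<lambda>x y. vabs (x - y)" by (rule Metric_space_vabs)
  show ?thesis by (auto simp: Qp_def vtop_def metric_closure_of)
qed

text \<open>The ultrametric inequality bounds a telescoping sum by its largest step, not by the
  total, so the distance to the limit keeps the bound \<open>c k\<close> without a constant. Digit
  expansions need this exact radius to stay inside one class.\<close>

lemma ultrametric_limit:
  assumes step: "\<And>k. vabs (s (Suc k) - s k) \<le> c k"
    and dec: "\<And>k. c (Suc k) \<le> c k" and lim: "c \<longlonglongrightarrow> 0"
  obtains x where "\<And>k. vabs (x - s k) \<le> c k"
proof -
  interpret Metric_space UNIV "\<lambda>x y. vabs (x - y)" by (rule Metric_space_vabs)
  have c0: "0 \<le> c k" for k using step[of k] vabs_nonneg[of "s (Suc k) - s k"] by linarith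
  have dec': "c m \<le> c k" if "k \<le> m" for k m using lift_Suc_antimono_le[of c] dec that by blast
  have close: "vabs (s m - s k) \<le> c k" if "k \<le> m" for k m
    using that
  proof (induction m rule: dec_induct)
    case base
    show ?case using c0 by (simp add: vabs_0)
  next
    case (step m)
    thus ?case using vabs_diff_le_max[of "s (Suc m)" "s k" "s m"] assms(1)[of m] dec'[of k m] by auto
  qed
  have "MCauchy s"
    unfolding MCauchy_def
  proof (intro conjI allI impI)
    fix e :: real assume "e > 0"
    then obtain N where "\<And>k. k \<ge> N \<Longrightarrow> c k < e"
      using order_tendstoD(2)[OF lim, of e] by (auto simp: eventually_sequentially)
    hence N: "c N < e" by simp
    have "vabs (s m - s k) < e" if "N \<le> m" "N \<le> k" for m k
      using vabs_diff_le_max[of "s m" "s k" "s N"] close[of N m] close[of N k] that N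
        vabs_minus_commute[of "s k" "s N"] by auto
    thus "\<exists>N. \<forall>n n'. N \<le> n \<longrightarrow> N \<le> n' \<longrightarrow> vabs (s n - s n') < e" by blast
  qed auto
  then obtain x where "limitin mtopology s x sequentially"
    using complete unfolding mcomplete_def by blast
  hence x: "\<exists>N. \<forall>n\<ge>N. vabs (s n - x) < e" if "e > 0" for e
    using that by (auto simp: limit_metric_sequentially)
  have "vabs (x - s k) \<le> c k" for k
  proof (rule field_le_epsilon)
    fix e :: real assume e: "e > 0"
    then obtain N where N: "\<forall>n\<ge>N. vabs (s n - x) < e" using x by blast
    have "vabs (x - s (max N k)) < e" using N vabs_minus_commute[of x] by simp
    thus "vabs (x - s k) \<le> c k + e"
      using vabs_diff_le_max[of x "s k" "s (max N k)"] close[of k "max N k"] c0[of k] e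
      by (auto simp: le_max_iff_disj)
  qed
  thus ?thesis by (rule that)
qed

lemma vabs_of_nat_le_1: "vabs (of_nat k) \<le> 1"
proof (induction k)
  case (Suc k)
  thus ?case using vabs_add_le_max[of 1 "of_nat k"] by (simp add: vabs_1)
qed (simp add: vabs_0)

lemma vabs_of_int_le_1: "vabs (of_int a) \<le> 1"
  by (cases a) (simp_all only: of_int_of_nat_eq of_int_minus vabs_minus vabs_of_nat_le_1)

lemma vabs_p_less_1: "vabs (of_nat p) < 1"
  using prime_gt_1_nat[OF prime_p] by (simp add: vabs_p)

text \<open>In the Bezout identity \<open>u * p + v * a = 1\<close> the first summand has absolute
  value below 1, so the second must carry the value 1; integers being bounded by 1, neither of its
  factors can be smaller.\<close>

lemma vabs_of_int_eq_1:
  assumes "\<not> int p dvd a"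
  shows "vabs (of_int a) = 1"
proof -
  have "coprime (int p) a" using assms prime_p by (intro prime_imp_coprime) auto
  then obtain u v where uv: "u * int p + v * a = 1"
    using bezout_int[of "int p" a] by auto
  have "1 = vabs (of_int (u * int p + v * a))" unfolding uv by (simp add: vabs_1)
  also have "\<dots> \<le> max (vabs (of_int u) * vabs (of_nat p)) (vabs (of_int v) * vabs (of_int a))"
    using vabs_add_le_max[of "of_int (u * int p)" "of_int (v * a)"] by (simp add: vabs_mult)
  finally have "1 \<le> vabs (of_int v) * vabs (of_int a)"
    using vabs_p_less_1 mult_left_le_one_le[OF vabs_nonneg vabs_nonneg vabs_of_int_le_1[of u], of "of_nat p"]
    by auto
  thus ?thesis
    using vabs_of_int_le_1[of a] mult_left_le_one_le[OF vabs_nonneg vabs_nonneg vabs_of_int_le_1[of v], of "of_int a"]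
    by linarith
qed

lemma vabs_of_int_less_1_iff: "vabs (of_int a) < 1 \<longleftrightarrow> int p dvd a"
proof
  assume "int p dvd a"
  then obtain b where "a = int p * b" by blast
  thus "vabs (of_int a) < 1"
    using mult_left_le[OF vabs_of_int_le_1[of b] vabs_nonneg, of "of_nat p"] vabs_p_less_1
    by (simp add: vabs_mult)
qed (use vabs_of_int_eq_1[of a] in auto)

lemma is_subfield_Qp: "is_subfield (Qp vabs)"
proof -
  have rat: "r \<in> Qp vabs" if "r \<in> \<rat>" for r
    unfolding mem_Qp_iff using that by (auto intro!: bexI[of _ r] simp: vabs_0)
  have add: "x + y \<in> Qp vabs" if x: "x \<in> Qp vabs" and y: "y \<in> Qp vabs" for x y
    unfolding mem_Qp_iff
  proof (intro allI impI)
    fix e :: real assume "e > 0"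
    then obtain r s where rs: "r \<in> \<rat>" "vabs (x - r) < e" "s \<in> \<rat>" "vabs (y - s) < e"
      using x y unfolding mem_Qp_iff by meson
    have "vabs (x + y - (r + s)) < e"
      using vabs_add_le_max[of "x - r" "y - s"] rs by (simp add: add_diff_add)
    thus "\<exists>r\<in>\<rat>. vabs (x + y - r) < e" using rs by (intro bexI[of _ "r + s"]) auto
  qed
  have mult: "x * y \<in> Qp vabs" if x: "x \<in> Qp vabs" and y: "y \<in> Qp vabs" for x y
    unfolding mem_Qp_iff
  proof (intro allI impI)
    fix e :: real assume e: "e > 0"
    \<comment> \<open>The \<open>+ 1\<close> keeps the denominator positive when
      \<open>x = 0\<close>. The error is split as \<open>x * (y - s) + s * (x - r)\<close>, so the
      tolerance \<open>d'\<close> for \<open>x\<close> is fixed only after \<open>s\<close> is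
      chosen.\<close>
    define d where "d = e / (vabs x + 1)"
    have d: "d > 0" using e vabs_nonneg[of x] by (simp add: d_def add_nonneg_pos)
    obtain s where s: "s \<in> \<rat>" "vabs (y - s) < d" using y d unfolding mem_Qp_iff by meson
    define d' where "d' = e / (vabs s + 1)"
    have d': "d' > 0" using e vabs_nonneg[of s] by (simp add: d'_def add_nonneg_pos)
    obtain r where r: "r \<in> \<rat>" "vabs (x - r) < d'" using x d' unfolding mem_Qp_iff by meson
    have "vabs x * vabs (y - s) < e"
    proof -
      have "vabs x * vabs (y - s) \<le> vabs x * d" using s vabs_nonneg[of x] by (intro mult_left_mono) auto
      also have "\<dots> < (vabs x + 1) * d" using d by (simp add: distrib_right)
      also have "\<dots> = e" using vabs_nonneg[of x] by (simp add: d_def)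
      finally show ?thesis .
    qed
    moreover have "vabs s * vabs (x - r) < e"
    proof -
      have "vabs s * vabs (x - r) \<le> vabs s * d'" using r vabs_nonneg[of s] by (intro mult_left_mono) auto
      also have "\<dots> < (vabs s + 1) * d'" using d' by (simp add: distrib_right)
      also have "\<dots> = e" using vabs_nonneg[of s] by (simp add: d'_def)
      finally show ?thesis .
    qed
    moreover have "x * y - r * s = x * (y - s) + s * (x - r)" by (simp add: algebra_simps)
    ultimately have "vabs (x * y - r * s) < e"
      using vabs_add_le_max[of "x * (y - s)" "s * (x - r)"] by (simp add: vabs_mult)
    thus "\<exists>r\<in>\<rat>. vabs (x * y - r) < e" using r s by (intro bexI[of _ "r * s"]) auto
  qed
  have inv: "inverse x \<in> Qp vabs" if x: "x \<in> Qp vabs" for x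
  proof (cases "x = 0")
    case True
    thus ?thesis using rat[of 0] by simp
  next
    case False
    hence x0: "vabs x > 0" using vabs_nonneg[of x] vabs_eq_0_iff[of x] by linarith
    show ?thesis unfolding mem_Qp_iff
    proof (intro allI impI)
      fix e :: real assume e: "e > 0"
      \<comment> \<open>The first bound forces \<open>vabs r = vabs x\<close>, so the denominator of
        \<open>inverse x - inverse r\<close> is known exactly; the second is \<open>e\<close> times
        that denominator.\<close>
      have "min (vabs x) (e * vabs x * vabs x) > 0" using e x0 by simp
      then obtain r where r: "r \<in> \<rat>" "vabs (x - r) < vabs x" "vabs (x - r) < e * vabs x * vabs x"
        using x unfolding mem_Qp_iff by (metis min_less_iff_conj)
      have "vabs (r - 0) = max (vabs (r - x)) (vabs (x - 0))"
        using r by (intro vabs_diff_eq_max) (simp add: vabs_minus_commute[of r x])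
      hence vr: "vabs r = vabs x" using r(2) by (simp add: vabs_minus_commute[of r x])
      hence "r \<noteq> 0" using x0 by (auto simp: vabs_0)
      hence "inverse x - inverse r = (r - x) * inverse x * inverse r"
        using False by (simp add: field_simps)
      hence "vabs (inverse x - inverse r) = vabs (x - r) / (vabs x * vabs x)"
        by (simp add: vabs_mult vabs_inverse vr vabs_minus_commute[of r x] divide_inverse)
      also have "\<dots> < e" using r(3) x0 by (simp add: field_simps)
      finally show "\<exists>r\<in>\<rat>. vabs (inverse x - r) < e" using r by (intro bexI[of _ "inverse r"]) auto
    qed
  qed
  have "- x \<in> Qp vabs" if "x \<in> Qp vabs" for x
    using mult[OF rat[of "-1"] that] by simp
  thus ?thesis unfolding is_subfield_def using add mult inv rat by auto
qed

text \<open>A rational of absolute value at most 1 has, in lowest terms, a denominator prime to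
  \<open>p\<close>; inverting it modulo \<open>p\<close> gives the integer. Relations over
  \<open>Qp\<close> can thus be reduced to integer relations.\<close>

lemma Qp_residue:
  assumes "x \<in> Qp vabs" "vabs x \<le> 1"
  obtains a :: int where "vabs (x - of_int a) < 1"
proof -
  obtain r where r: "r \<in> \<rat>" "vabs (x - r) < 1" using assms(1) unfolding mem_Qp_iff by (meson zero_less_one)
  have r1: "vabs r \<le> 1" using vabs_diff_le_max[of r 0 x] r(2) assms(2) vabs_minus_commute[of r x] by simp
  obtain u v where uv: "v > 0" "coprime u v" "r = of_int u / of_int v"
    using Rats_cases'[OF r(1)] by metis
  have rv: "of_int u = r * of_int v" using uv by simp
  have v1: "\<not> int p dvd v"
  proof
    assume v: "int p dvd v"
    hence "vabs (of_int v) < 1" by (simp add: vabs_of_int_less_1_iff)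
    hence "vabs (of_int u) < 1" unfolding rv
      using mult_left_le_one_le[OF vabs_nonneg vabs_nonneg r1, of "of_int v"] by (simp add: vabs_mult)
    hence "int p dvd u" by (simp add: vabs_of_int_less_1_iff)
    with v uv(2) have "is_unit (int p)" by (meson coprime_common_divisor)
    thus False using prime_gt_1_nat[OF prime_p] by simp
  qed
  hence "coprime (int p) v" using prime_p by (intro prime_imp_coprime) auto
  then obtain s t where st: "s * int p + t * v = 1"
    using bezout_int[of "int p" v] by auto
  have v0: "(of_int v :: 'k) \<noteq> 0" using uv by simp
  have "r - of_int (u * t) = r * (1 - of_int (t * v))" by (simp add: rv algebra_simps)
  also have "(1 - of_int (t * v) :: 'k) = of_int (1 - t * v)" by simp
  also have "1 - t * v = s * int p" using st by simp
  finally have "vabs (r - of_int (u * t)) = vabs r * vabs (of_int (s * int p))" by (simp only: vabs_mult)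
  also have "\<dots> \<le> vabs (of_int (s * int p))"
    using mult_left_le_one_le[OF vabs_nonneg vabs_nonneg r1] by blast
  also have "\<dots> < 1" by (subst vabs_of_int_less_1_iff) simp
  finally show ?thesis using that[of "u * t"] vabs_diff_le_max[of x "of_int (u * t)" r] r(2) by auto
qed

section \<open>Points of type I in the Berkovich line\<close>

lemma D_mult_seminorms: "0 \<le> r \<Longrightarrow> D a r \<in> mult_seminorms vabs"
  using disc_point_in_P1[of r a] by (auto simp: berk_P1_def disc_point_def)

lemma vabs_add_le: "vabs (x + y) \<le> vabs x + vabs y"
  using vabs_add_le_max[of x y] vabs_nonneg[of x] vabs_nonneg[of y] by linarith

text \<open>Near \<open>x\<close> one has \<open>f(y) - f(x) = (y - x) * g(y)\<close>, and on the
  unit disc about \<open>x\<close> the cofactor is bounded by its sup norm \<open>D x 1 g\<close>.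
  This is a local Lipschitz estimate.\<close>

lemma continuous_vabs_poly: "continuous_map (vtop vabs) euclideanreal (\<lambda>x. vabs (poly f x))"
proof -
  interpret Metric_space UNIV "\<lambda>x y. vabs (x - y)" by (rule Metric_space_vabs)
  have local: "\<exists>d>0. \<forall>y. vabs (x - y) < d \<longrightarrow> \<bar>vabs (poly f y) - vabs (poly f x)\<bar> < e" if "e > 0" for x e
  proof -
    have "poly (f - [:poly f x:]) x = 0" by simp
    then obtain g where g: "f - [:poly f x:] = [:- x, 1:] * g"
      unfolding poly_eq_0_iff_dvd by blast
    have diff: "poly f y - poly f x = (y - x) * poly g y" for y
      using arg_cong[OF g, of "\<lambda>h. poly h y"] by (simp add: algebra_simps)
    define C where "C = D x 1 g + 1"
    have "0 \<le> D x 1 g" using D_upper[of x x 1 g] vabs_nonneg[of "poly g x"] by (simp add: vabs_0)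
    hence C: "C > 0" by (simp add: C_def)
    have "\<bar>vabs (poly f y) - vabs (poly f x)\<bar> < e" if y: "vabs (x - y) < min 1 (e / C)" for y
    proof -
      have yx: "vabs (y - x) < 1" "vabs (y - x) < e / C" using y vabs_minus_commute[of x y] by auto
      have "vabs (poly g y) \<le> C" using D_upper[of y x 1 g] yx by (simp add: C_def)
      hence "vabs (poly f y - poly f x) \<le> vabs (y - x) * C"
        unfolding diff vabs_mult by (intro mult_left_mono vabs_nonneg)
      also have "\<dots> < e" using yx(2) C by (simp add: field_simps)
      finally have d: "vabs (poly f y - poly f x) < e" .
      have "vabs (poly f y) \<le> vabs (poly f x) + vabs (poly f y - poly f x)"
        using vabs_add_le[of "poly f x" "poly f y - poly f x"] by simp
      moreover have "vabs (poly f x) \<le> vabs (poly f y) + vabs (poly f y - poly f x)"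
        using vabs_add_le[of "poly f y" "poly f x - poly f y"] vabs_minus_commute[of "poly f x" "poly f y"]
        by simp
      ultimately show ?thesis using d by linarith
    qed
    moreover have "min 1 (e / C) > 0" using C that by simp
    ultimately show ?thesis by blast
  qed
  show ?thesis unfolding continuous_map_def vtop_def
  proof (intro conjI allI impI)
    fix U :: "real set" assume "openin euclideanreal U"
    hence U: "open U" by simp
    show "openin mtopology {x \<in> topspace mtopology. vabs (poly f x) \<in> U}"
      unfolding openin_mtopology
    proof (intro conjI allI impI)
      fix x assume "x \<in> {x \<in> topspace mtopology. vabs (poly f x) \<in> U}"
      then obtain e where e: "e > 0" "\<And>t. dist t (vabs (poly f x)) < e \<Longrightarrow> t \<in> U"
        using U unfolding open_dist by blast
      obtain d where "d > 0" "\<And>y. vabs (x - y) < d \<Longrightarrow> \<bar>vabs (poly f y) - vabs (poly f x)\<bar> < e"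
        using local[OF e(1)] by blast
      thus "\<exists>r>0. mball x r \<subseteq> {x \<in> topspace mtopology. vabs (poly f x) \<in> U}"
        using e(2) by (intro exI[of _ d]) (auto simp: dist_real_def)
    qed auto
  qed auto
qed

lemma D_0: "D x 0 f = vabs (poly f x)"
proof -
  obtain l A where f: "f = smult l (\<Prod>c\<in>#A. [:-c, 1:])" by (rule poly_split)
  show ?thesis unfolding f D_split[OF order_refl] vabs_poly_split by (simp add: max_absorb1 vabs_nonneg)
qed

text \<open>Pulls open sets of the Berkovich line back to open sets of the valued field; this makes
  the map defining \<open>haar\<close> measurable.\<close>

lemma continuous_disc_point: "continuous_map (vtop vabs) (berk_P1 vabs) (\<lambda>x. disc_point vabs x 0)"
proof -
  have "continuous_map (vtop vabs) (powertop_real UNIV) (\<lambda>x. D x 0)"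
    unfolding continuous_map_componentwise_UNIV D_0 by (intro allI continuous_vabs_poly)
  hence "continuous_map (vtop vabs) (subtopology (powertop_real UNIV) (mult_seminorms vabs)) (\<lambda>x. D x 0)"
    using D_mult_seminorms by (simp add: continuous_map_in_subtopology)
  from continuous_map_compose[OF this continuous_map_Some] show ?thesis
    by (simp add: berk_P1_def disc_point_def[abs_def] o_def)
qed

text \<open>Over an algebraically closed field a multiplicative seminorm is determined by its values
  on the polynomials \<open>T - c\<close>. Once \<open>T - y\<close> has value 0, the triangle
  inequality in both directions pins these to \<open>vabs (y - c)\<close>.\<close>

lemma seminorm_eq_evaluation:
  assumes \<nu>: "\<nu> \<in> mult_seminorms vabs" and y: "\<nu> [:- y, 1:] = 0"
  shows "\<nu> = D y 0"
proof
  fix f :: "'k poly"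
  have add: "\<nu> (f + g) \<le> \<nu> f + \<nu> g" and const: "\<nu> [:c:] = vabs c" for f g c
    using \<nu> by (auto simp: mult_seminorms_def)
  have lin: "\<nu> [:- c, 1:] = vabs (y - c)" for c
  proof (rule antisym)
    show "\<nu> [:- c, 1:] \<le> vabs (y - c)" using add[of "[:- y, 1:]" "[:y - c:]"] y const by simp
    have "\<nu> ([:- 1:] * [:- y, 1:]) = \<nu> [:- 1:] * \<nu> [:- y, 1:]"
      using \<nu> unfolding mult_seminorms_def by blast
    hence "\<nu> [:y, - 1:] = 0" using y by simp
    thus "vabs (y - c) \<le> \<nu> [:- c, 1:]" using add[of "[:- c, 1:]" "[:y, - 1:]"] const[of "y - c"] by simp
  qed
  obtain l A where f: "f = smult l (\<Prod>c\<in>#A. [:-c, 1:])" by (rule poly_split)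
  show "\<nu> f = D y 0 f"
    unfolding f seminorm_split[OF \<nu>] D_split[OF order_refl] lin by (simp add: max_absorb1 vabs_nonneg)
qed

end

subsection \<open>Finiteness of the residue field\<close>

text \<open>Elimination of unknowns relative to a subfield given as a set, since \<open>Qp\<close>
  is not a type.\<close>

lemma homogeneous_system_solution:
  fixes c :: "'i \<Rightarrow> 'b \<Rightarrow> 'a::field"
  assumes K: "is_subfield K" and "finite B" "finite I" "card B < card I"
    and "\<And>i b. i \<in> I \<Longrightarrow> b \<in> B \<Longrightarrow> c i b \<in> K"
  shows "\<exists>x. (\<forall>i\<in>I. x i \<in> K) \<and> (\<exists>i\<in>I. x i \<noteq> 0) \<and> (\<forall>b\<in>B. (\<Sum>i\<in>I. x i * c i b) = 0)"
  using assms(2-)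
proof (induction B arbitrary: I c rule: finite_induct)
  case empty
  hence "I \<noteq> {}" by auto
  thus ?case using K by (intro exI[of _ "\<lambda>_. 1"]) (auto simp: is_subfield_def)
next
  case (insert b B)
  have Kadd: "x + y \<in> K" and Kmult: "x * y \<in> K" if "x \<in> K" "y \<in> K" for x y
    using K that by (auto simp: is_subfield_def)
  have Kminus: "- x \<in> K" and Kinv: "inverse x \<in> K" if "x \<in> K" for x
    using K that by (auto simp: is_subfield_def)
  have Kdiff: "x - y \<in> K" if "x \<in> K" "y \<in> K" for x y
    using Kadd[OF that(1) Kminus[OF that(2)]] by simp
  have Kdiv: "x / y \<in> K" if "x \<in> K" "y \<in> K" for x y
    using Kmult[OF that(1) Kinv[OF that(2)]] by (simp add: divide_inverse)
  have Ksum: "(\<Sum>i\<in>A. f i) \<in> K" if "\<And>i. i \<in> A \<Longrightarrow> f i \<in> K" for f and A :: "'i set"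
    using that by (induction A rule: infinite_finite_induct) (use K in \<open>auto simp: is_subfield_def\<close>)
  show ?case
  proof (cases "\<forall>i\<in>I. c i b = 0")
    case True
    have "card B < card I" using insert by simp
    then obtain x where "\<forall>i\<in>I. x i \<in> K" "\<exists>i\<in>I. x i \<noteq> 0" "\<forall>b\<in>B. (\<Sum>i\<in>I. x i * c i b) = 0"
      using insert.IH[of I c] insert.prems by auto
    thus ?thesis using True by (intro exI[of _ x]) auto
  next
    case False
    then obtain j where j: "j \<in> I" "c j b \<noteq> 0" by blast
    \<comment> \<open>Pivot step: equation \<open>b\<close> is solved for the unknown
      \<open>j\<close> and substituted into the others; \<open>t\<close> below is the resulting
      value of that unknown.\<close>
    define c' where "c' i b' = c i b' - c i b / c j b * c j b'" for i b'
    have "card B < card (I - {j})" using insert j by simp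
    moreover have "c' i b' \<in> K" if "i \<in> I - {j}" "b' \<in> B" for i b'
      unfolding c'_def using that j insert.prems by (intro Kdiff Kmult Kdiv) auto
    ultimately obtain x where x: "\<forall>i\<in>I - {j}. x i \<in> K" "\<exists>i\<in>I - {j}. x i \<noteq> 0"
      "\<forall>b'\<in>B. (\<Sum>i\<in>I - {j}. x i * c' i b') = 0"
      using insert.IH[of "I - {j}" c'] insert.prems by blast
    define t where "t = - (\<Sum>i\<in>I - {j}. x i * c i b) / c j b"
    have t: "t \<in> K" unfolding t_def using x j insert.prems
      by (intro Kdiv Kminus Ksum Kmult) auto
    have sum: "(\<Sum>i\<in>I. (x(j := t)) i * c i b') = t * c j b' + (\<Sum>i\<in>I - {j}. x i * c i b')" for b'
      using insert.prems(1) j by (subst sum.remove[of I j]) (auto intro!: sum.cong)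
    have "(\<Sum>i\<in>I. (x(j := t)) i * c i b') = 0" if "b' \<in> insert b B" for b'
    proof (cases "b' = b")
      case True
      thus ?thesis unfolding sum using j by (simp add: t_def)
    next
      case False
      hence "0 = (\<Sum>i\<in>I - {j}. x i * c' i b')" using x that by simp
      also have "\<dots> = (\<Sum>i\<in>I - {j}. x i * c i b') - (\<Sum>i\<in>I - {j}. x i * c i b) / c j b * c j b'"
        by (simp add: c'_def right_diff_distrib sum_subtractf sum_distrib_right sum_divide_distrib mult.assoc)
      finally show ?thesis unfolding sum by (simp add: t_def)
    qed
    moreover have "\<forall>i\<in>I. (x(j := t)) i \<in> K" "\<exists>i\<in>I. (x(j := t)) i \<noteq> 0" using x t by auto
    ultimately show ?thesis by blast
  qed
qed

locale padic_local_field = padic_complex_field p vabs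
  for p and vabs :: "'k::{alg_closed_field, field_char_0} \<Rightarrow> real" +
  fixes L :: "'k set" and \<pi> :: 'k
  assumes finite_ext: "finite_extension_Qp vabs L" and unif: "uniformizer vabs L \<pi>"
begin

lemma Qp_subset_L: "Qp vabs \<subseteq> L"
  using finite_ext by (simp add: finite_extension_Qp_def)

lemma subfield_L: "is_subfield L"
  using finite_ext by (simp add: finite_extension_Qp_def)

lemma L_0: "0 \<in> L" and L_1: "1 \<in> L"
  using subfield_L by (auto simp: is_subfield_def)

lemma L_add: "x \<in> L \<Longrightarrow> y \<in> L \<Longrightarrow> x + y \<in> L"
  and L_mult: "x \<in> L \<Longrightarrow> y \<in> L \<Longrightarrow> x * y \<in> L"
  and L_minus: "x \<in> L \<Longrightarrow> - x \<in> L"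
  and L_inverse: "x \<in> L \<Longrightarrow> inverse x \<in> L"
  using subfield_L by (auto simp: is_subfield_def)

lemma L_diff: "x \<in> L \<Longrightarrow> y \<in> L \<Longrightarrow> x - y \<in> L"
  using L_add[of x "- y"] L_minus[of y] by simp

lemma L_divide: "x \<in> L \<Longrightarrow> y \<in> L \<Longrightarrow> x / y \<in> L"
  by (simp add: divide_inverse L_mult L_inverse)

lemma L_power: "x \<in> L \<Longrightarrow> x ^ k \<in> L"
  by (induction k) (auto simp: L_1 L_mult)

lemma L_sum: "(\<And>i. i \<in> A \<Longrightarrow> f i \<in> L) \<Longrightarrow> (\<Sum>i\<in>A. f i) \<in> L"
  by (induction A rule: infinite_finite_induct) (auto simp: L_0 L_add)

lemma L_of_nat: "of_nat k \<in> L"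
  by (induction k) (auto simp: L_0 L_1 L_add)

text \<open>Linear independence of the residues of \<open>S\<close> over the prime field, expressed
  with integers: a sum reduces to 0 when its absolute value is below 1, a coefficient when
  \<open>p\<close> divides it.\<close>

definition residue_independent :: "'k set \<Rightarrow> bool" where
  "residue_independent S \<longleftrightarrow> finite S \<and> S \<subseteq> integer_ring vabs L \<and>
     (\<forall>a. vabs (\<Sum>s\<in>S. of_int (a s) * s) < 1 \<longrightarrow> (\<forall>s\<in>S. int p dvd a s))"

text \<open>A \<open>\<rat>\<^sub>p\<close>-linear relation, scaled so that its largest coefficient is \<open>1\<close>, reduces to a
  nontrivial relation over the prime field.\<close>

lemma residue_independent_card_bounded:
  obtains d where "\<And>S. residue_independent S \<Longrightarrow> card S \<le> d"
proof -
  obtain B where B: "finite B" "B \<subseteq> L"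
    "\<forall>x\<in>L. \<exists>c. (\<forall>b\<in>B. c b \<in> Qp vabs) \<and> x = (\<Sum>b\<in>B. c b * b)"
    using finite_ext unfolding finite_extension_Qp_def by blast
  have "card S \<le> card B" if S: "residue_independent S" for S
  proof (rule ccontr)
    assume "\<not> card S \<le> card B"
    hence card: "card B < card S" by simp
    have SO: "s \<in> L" "vabs s \<le> 1" if "s \<in> S" for s
      using S that by (auto simp: residue_independent_def integer_ring_def)
    have finS: "finite S" using S by (simp add: residue_independent_def)
    have "\<forall>s\<in>S. \<exists>c. (\<forall>b\<in>B. c b \<in> Qp vabs) \<and> s = (\<Sum>b\<in>B. c b * b)" using B SO by blast
    then obtain c where c: "\<And>s b. s \<in> S \<Longrightarrow> b \<in> B \<Longrightarrow> c s b \<in> Qp vabs"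
      "\<And>s. s \<in> S \<Longrightarrow> s = (\<Sum>b\<in>B. c s b * b)" by (metis (no_types))
    obtain x where x: "\<And>s. s \<in> S \<Longrightarrow> x s \<in> Qp vabs" "\<exists>s\<in>S. x s \<noteq> 0"
      "\<And>b. b \<in> B \<Longrightarrow> (\<Sum>s\<in>S. x s * c s b) = 0"
      using homogeneous_system_solution[OF is_subfield_Qp B(1) finS card, of c] c(1) by blast
    have "(\<Sum>s\<in>S. x s * s) = (\<Sum>s\<in>S. x s * (\<Sum>b\<in>B. c s b * b))"
      using c(2) by (intro sum.cong) auto
    also have "\<dots> = (\<Sum>b\<in>B. (\<Sum>s\<in>S. x s * c s b) * b)"
      unfolding sum_distrib_left sum_distrib_right by (subst sum.swap) (simp add: mult.assoc)
    finally have x0: "(\<Sum>s\<in>S. x s * s) = 0" using x(3) by simp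
    have "S \<noteq> {}" using card by auto
    then obtain m where m: "m \<in> S" "\<And>s. s \<in> S \<Longrightarrow> vabs (x s) \<le> vabs (x m)"
      using Max_in[of "(\<lambda>s. vabs (x s)) ` S"] Max_ge[of "(\<lambda>s. vabs (x s)) ` S"] finS by fastforce
    have xm: "x m \<noteq> 0"
    proof
      assume "x m = 0"
      hence "vabs (x s) = 0" if "s \<in> S" for s using m(2)[OF that] vabs_nonneg[of "x s"] by (simp add: vabs_0)
      thus False using x(2) by (simp add: vabs_eq_0_iff)
    qed
    hence vxm: "vabs (x m) > 0" using vabs_nonneg[of "x m"] vabs_eq_0_iff[of "x m"] by linarith
    define y where "y s = x s * inverse (x m)" for s
    have y: "y s \<in> Qp vabs" "vabs (y s) \<le> 1" if "s \<in> S" for s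
    proof -
      show "y s \<in> Qp vabs" using is_subfield_Qp x(1) m that by (simp add: y_def is_subfield_def)
      show "vabs (y s) \<le> 1" 
        unfolding y_def vabs_mult vabs_inverse using m(2)[OF that] vxm by (simp add: field_simps)
    qed
    have "(\<Sum>s\<in>S. y s * s) = inverse (x m) * (\<Sum>s\<in>S. x s * s)"
      unfolding y_def sum_distrib_left by (intro sum.cong) auto
    hence y0: "(\<Sum>s\<in>S. y s * s) = 0" by (simp add: x0)
    have "\<forall>s\<in>S. \<exists>a::int. vabs (y s - of_int a) < 1" using Qp_residue y by metis
    then obtain a :: "'k \<Rightarrow> int" where a: "\<And>s. s \<in> S \<Longrightarrow> vabs (y s - of_int (a s)) < 1"
      by (metis (no_types))
    have "vabs (\<Sum>s\<in>S. s * (of_int (a s) - y s)) < 1"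
      using a SO by (intro vabs_sum_less vabs_mult_less_1) (auto simp: vabs_minus_commute)
    also have "(\<Sum>s\<in>S. s * (of_int (a s) - y s)) = (\<Sum>s\<in>S. of_int (a s) * s)"
      using y0 by (simp add: right_diff_distrib sum_subtractf mult.commute)
    finally have "int p dvd a m" using S m(1) by (auto simp: residue_independent_def)
    hence "vabs (of_int (a m)) < 1" by (simp add: vabs_of_int_less_1_iff)
    moreover have "vabs (1 - of_int (a m)) < 1" using a[OF m(1)] xm by (simp add: y_def)
    ultimately have "vabs (1 - of_int (a m) + of_int (a m)) < 1" by (intro vabs_add_less)
    thus False by (simp add: vabs_1)
  qed
  thus ?thesis by (rule that)
qed

text \<open>An independent \<open>S\<close> of maximal size spans the residue field over the prime
  field, so combinations with coefficients in \<open>{0..<p}\<close> already meet every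
  class.\<close>

lemma residues_finite:
  obtains T where "finite T" "\<And>x. x \<in> integer_ring vabs L \<Longrightarrow> \<exists>t\<in>T. vabs (x - t) < 1"
proof -
  obtain d where d: "\<And>S. residue_independent S \<Longrightarrow> card S \<le> d"
    using residue_independent_card_bounded by blast
  have "residue_independent {}" by (simp add: residue_independent_def)
  then obtain S where S: "residue_independent S"
    and max: "\<And>S'. residue_independent S' \<Longrightarrow> card S' \<le> card S"
    using ex_has_greatest_nat[of residue_independent "{}" card "Suc d"] d by (auto simp: less_Suc_eq_le)
  have finS: "finite S" and SO: "\<And>s. s \<in> S \<Longrightarrow> vabs s \<le> 1"
    using S by (auto simp: residue_independent_def integer_ring_def)
  \<comment> \<open>\<open>S\<close> is added so that an \<open>x\<close> in \<open>S\<close>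
    represents itself; any other \<open>x\<close> makes \<open>insert x S\<close> strictly larger,
    hence dependent.\<close>
  define T where "T = (\<lambda>b. \<Sum>s\<in>S. of_int (b s) * s) ` (S \<rightarrow>\<^sub>E {0..<int p}) \<union> S"
  have "\<exists>t\<in>T. vabs (x - t) < 1" if x: "x \<in> integer_ring vabs L" for x
  proof (cases "x \<in> S")
    case True
    thus ?thesis by (auto simp: T_def vabs_0 intro!: bexI[of _ x])
  next
    case False
    have x1: "vabs x \<le> 1" using x by (simp add: integer_ring_def)
    have "card (insert x S) > card S" using False finS by simp
    hence "\<not> residue_independent (insert x S)" using max[of "insert x S"] by linarith
    then obtain a where a: "vabs (\<Sum>s\<in>insert x S. of_int (a s) * s) < 1" "\<exists>s\<in>insert x S. \<not> int p dvd a s"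
      using S x finS unfolding residue_independent_def by auto
    define \<Sigma> where "\<Sigma> = (\<Sum>s\<in>S. of_int (a s) * s)"
    have a1: "vabs (of_int (a x) * x + \<Sigma>) < 1" using a(1) False finS by (simp add: \<Sigma>_def)
    have ax: "\<not> int p dvd a x"
    proof
      assume p: "int p dvd a x"
      hence "vabs (x * of_int (a x)) < 1" using x1 by (intro vabs_mult_less_1) (auto simp: vabs_of_int_less_1_iff)
      from vabs_diff_less[OF a1 this] have "vabs \<Sigma> < 1" by (simp add: mult.commute)
      hence "\<forall>s\<in>S. int p dvd a s" using S by (auto simp: residue_independent_def \<Sigma>_def)
      thus False using a(2) p by blast
    qed
    hence "coprime (int p) (a x)" using prime_p by (intro prime_imp_coprime) auto
    \<comment> \<open>\<open>t\<close> inverts \<open>a x\<close> modulo \<open>p\<close>, so the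
      relation says that \<open>x\<close> is congruent to \<open>- t * \<Sigma>\<close>; reducing
      those coefficients modulo \<open>p\<close> gives \<open>b\<close>.\<close>
    then obtain u t where ut: "u * int p + t * a x = 1" using bezout_int[of "int p" "a x"] by auto
    define b where "b = restrict (\<lambda>s. (- t * a s) mod int p) S"
    have "b \<in> S \<rightarrow>\<^sub>E {0..<int p}" using prime_gt_0_nat[OF prime_p] by (auto simp: b_def)
    hence bT: "(\<Sum>s\<in>S. of_int (b s) * s) \<in> T" by (auto simp: T_def)
    have e1: "x + of_int t * \<Sigma> = x * of_int (u * int p) + of_int t * (of_int (a x) * x + \<Sigma>)"
    proof -
      have "x = x * of_int (u * int p + t * a x)" using ut by simp
      thus ?thesis by (simp add: algebra_simps)
    qed
    have 1: "vabs (x + of_int t * \<Sigma>) < 1" unfolding e1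
    proof (rule vabs_add_less)
      show "vabs (x * of_int (u * int p)) < 1"
        using x1 by (intro vabs_mult_less_1) (simp_all only: vabs_of_int_less_1_iff dvd_triv_right)
      show "vabs (of_int t * (of_int (a x) * x + \<Sigma>)) < 1"
        by (rule vabs_mult_less_1[OF vabs_of_int_le_1 a1])
    qed
    have e2: "of_int t * \<Sigma> + (\<Sum>s\<in>S. of_int (b s) * s) = (\<Sum>s\<in>S. s * of_int (t * a s + b s))"
      unfolding \<Sigma>_def sum_distrib_left sum.distrib[symmetric] by (intro sum.cong) (auto simp: algebra_simps)
    have 2: "vabs (of_int t * \<Sigma> + (\<Sum>s\<in>S. of_int (b s) * s)) < 1" unfolding e2
    proof (intro vabs_sum_less vabs_mult_less_1)
      fix s assume s: "s \<in> S"
      have "int p dvd (- t * a s) mod int p - (- t * a s)" 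
        by (subst dvd_diff_commute) (rule dvd_minus_mod)
      thus "vabs (of_int (t * a s + b s)) < 1" using s by (simp add: b_def vabs_of_int_less_1_iff add.commute del: of_int_add of_int_mult)
    qed (use SO in auto)
    have "vabs (x - (\<Sum>s\<in>S. of_int (b s) * s)) < 1" using vabs_diff_less[OF 1 2] by simp
    thus ?thesis using bT by blast
  qed
  moreover have "finite T" using finS by (auto simp: T_def intro!: finite_PiE)
  ultimately show ?thesis using that by blast
qed

abbreviation q :: nat where "q \<equiv> residue_field_order vabs L"

text \<open>One representative from each class turns the quotient behind \<open>q\<close> into
  actual digits. Finiteness has to be settled, since \<open>card\<close> of an infinite quotient is
  0.\<close>

lemma digits_exist:
  obtains A where "finite A" "card A = q" "A \<subseteq> integer_ring vabs L"
    "\<And>x. x \<in> integer_ring vabs L \<Longrightarrow> \<exists>!d. d \<in> A \<and> vabs (x - d) < 1"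
proof -
  let ?O = "integer_ring vabs L"
  define R where "R = {(x, y) \<in> ?O \<times> ?O. x - y \<in> maximal_ideal vabs L}"
  have R: "(x, y) \<in> R \<longleftrightarrow> x \<in> ?O \<and> y \<in> ?O \<and> vabs (x - y) < 1" for x y
    by (auto simp: R_def maximal_ideal_def integer_ring_def L_diff)
  have equiv: "equiv ?O R"
  proof (rule equivI)
    show "R \<subseteq> ?O \<times> ?O" by (auto simp: R_def)
    show "refl_on ?O R" by (auto simp: refl_on_def R vabs_0)
    show "sym R" by (auto simp: sym_def R vabs_minus_commute)
    show "trans R"
    proof (rule transI)
      fix x y z assume "(x, y) \<in> R" "(y, z) \<in> R"
      thus "(x, z) \<in> R" using vabs_diff_le_max[of x z y] by (auto simp: R)
    qed
  qed
  obtain T where T: "finite T" "\<And>x. x \<in> ?O \<Longrightarrow> \<exists>t\<in>T. vabs (x - t) < 1"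
    using residues_finite by blast
  have "?O // R \<subseteq> (\<lambda>t. {y \<in> ?O. vabs (y - t) < 1}) ` T"
  proof
    fix X assume "X \<in> ?O // R"
    then obtain x where x: "x \<in> ?O" "X = R `` {x}" by (auto simp: quotient_def)
    obtain t where t: "t \<in> T" "vabs (x - t) < 1" using T x by blast
    have iff: "vabs (x - y) < 1 \<longleftrightarrow> vabs (y - t) < 1" for y
      using vabs_diff_less[OF t(2), of "x - y"] vabs_diff_less[OF t(2), of "y - t"]
      by (simp, argo)
    have "X = {y \<in> ?O. vabs (x - y) < 1}" unfolding x(2) using x(1) by (simp add: set_eq_iff R)
    hence "X = {y \<in> ?O. vabs (y - t) < 1}" by (simp only: iff)
    thus "X \<in> (\<lambda>t. {y \<in> ?O. vabs (y - t) < 1}) ` T" using t by blast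
  qed
  hence fin: "finite (?O // R)" using T(1) finite_surj by blast
  define rep where "rep X = (SOME x. x \<in> X)" for X :: "'k set"
  have rep: "rep X \<in> X" if "X \<in> ?O // R" for X
    using in_quotient_imp_non_empty[OF equiv that] by (simp add: rep_def some_in_eq)
  define A where "A = rep ` (?O // R)"
  have "inj_on rep (?O // R)"
    using quotient_disj[OF equiv] rep by (auto simp: inj_on_def) (metis disjoint_iff)+
  hence "card A = q" unfolding A_def by (simp add: card_image residue_field_order_def R_def)
  moreover have "A \<subseteq> ?O" using rep in_quotient_imp_subset[OF equiv] by (auto simp: A_def)
  moreover have "\<exists>!d. d \<in> A \<and> vabs (x - d) < 1" if x: "x \<in> ?O" for x
  proof (rule ex1I[of _ "rep (R `` {x})"])
    have X: "R `` {x} \<in> ?O // R" using x by (rule quotientI)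
    have "rep (R `` {x}) \<in> R `` {x}" by (rule rep[OF X])
    thus "rep (R `` {x}) \<in> A \<and> vabs (x - rep (R `` {x})) < 1" using X by (auto simp: A_def R)
    fix d assume "d \<in> A \<and> vabs (x - d) < 1"
    then obtain Y where Y: "Y \<in> ?O // R" "d = rep Y" "vabs (x - d) < 1" by (auto simp: A_def)
    have dY: "d \<in> Y" using rep Y by simp
    moreover have "d \<in> ?O" using dY in_quotient_imp_subset[OF equiv Y(1)] by blast
    ultimately have "Y = R `` {x}"
      using quotient_eqI[OF equiv Y(1) X, of d x] x Y(3) by (auto simp: R vabs_0 vabs_minus_commute)
    thus "d = rep (R `` {x})" using Y by simp
  qed
  ultimately show ?thesis using that[of A] fin by (simp add: A_def)
qed

subsection \<open>Digit expansions and completeness of \<open>L\<close>\<close>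

lemma uniformizer_L: "\<pi> \<in> L"
  and vabs_uniformizer_less_1: "vabs \<pi> < 1"
  and vabs_uniformizer_pos: "0 < vabs \<pi>"
proof -
  have m: "maximal_ideal vabs L = (\<lambda>y. \<pi> * y) ` integer_ring vabs L"
    using unif by (simp add: uniformizer_def)
  show "\<pi> \<in> L" using unif by (simp add: uniformizer_def)
  have "1 \<in> integer_ring vabs L" by (simp add: integer_ring_def L_1 vabs_1)
  hence "\<pi> * 1 \<in> maximal_ideal vabs L" unfolding m by (rule imageI)
  thus "vabs \<pi> < 1" by (simp add: maximal_ideal_def)
  \<comment> \<open>The nonzero element \<open>p\<close> of the maximal ideal excludes
    \<open>\<pi> = 0\<close>.\<close>
  have "of_nat p \<in> maximal_ideal vabs L" by (simp add: maximal_ideal_def L_of_nat vabs_p_less_1)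
  then obtain y where "of_nat p = \<pi> * y" unfolding m by blast
  moreover have "(of_nat p :: 'k) \<noteq> 0" using prime_gt_0_nat[OF prime_p] by simp
  ultimately have "\<pi> \<noteq> 0" by auto
  thus "0 < vabs \<pi>" using vabs_nonneg[of \<pi>] vabs_eq_0_iff[of \<pi>] by linarith
qed

lemma uniformizer_nonzero: "\<pi> \<noteq> 0"
  using vabs_uniformizer_pos by (auto simp: vabs_0)

lemma uniformizer_power_le: "j \<le> k \<Longrightarrow> vabs \<pi> ^ k \<le> vabs \<pi> ^ j"
  using vabs_uniformizer_pos vabs_uniformizer_less_1 by (intro power_decreasing) auto

text \<open>Division by \<open>\<pi> ^ k\<close> moves \<open>x\<close> into the maximal ideal,
  which \<open>\<pi>\<close> generates. Strict bounds at one level thus become weak bounds at the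
  next.\<close>

lemma vabs_discrete:
  assumes "x \<in> L" "vabs x < vabs \<pi> ^ k"
  shows "vabs x \<le> vabs \<pi> ^ Suc k"
proof -
  define y where "y = x / \<pi> ^ k"
  have "vabs (\<pi> ^ k) > 0" using vabs_uniformizer_pos by (simp add: vabs_power)
  hence "vabs y < 1" using assms(2)
    by (simp add: y_def divide_inverse vabs_mult vabs_inverse vabs_power) (simp add: field_simps)
  hence "y \<in> maximal_ideal vabs L"
    using assms(1) by (auto simp: maximal_ideal_def y_def intro!: L_divide L_power uniformizer_L)
  then obtain z where z: "y = \<pi> * z" "vabs z \<le> 1"
    using unif by (auto simp: uniformizer_def integer_ring_def)
  have "x = \<pi> ^ Suc k * z" using z(1) uniformizer_nonzero by (simp add: y_def field_simps)
  thus ?thesis using z(2) vabs_uniformizer_pos by (simp add: vabs_mult vabs_power mult_left_le)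
qed

lemma mem_unit_group_iff: "x \<in> unit_group vabs L \<longleftrightarrow> x \<in> L \<and> vabs x = 1"
proof
  assume "x \<in> unit_group vabs L"
  then obtain y where y: "x \<in> L" "vabs x \<le> 1" "vabs y \<le> 1" "x * y = 1"
    by (auto simp: unit_group_def integer_ring_def)
  have "vabs x * vabs y = 1" using y(4) by (metis vabs_1 vabs_mult)
  hence "1 \<le> vabs x" using y mult_left_le[OF y(3) vabs_nonneg[of x]] by simp
  thus "x \<in> L \<and> vabs x = 1" using y by simp
next
  assume x: "x \<in> L \<and> vabs x = 1"
  hence "x \<noteq> 0" by (auto simp: vabs_0)
  hence "inverse x \<in> integer_ring vabs L \<and> x * inverse x = 1"
    using x by (simp add: integer_ring_def L_inverse vabs_inverse)
  thus "x \<in> unit_group vabs L" using x unfolding unit_group_def by (auto simp: integer_ring_def)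
qed

definition digits :: "'k set" where
  "digits = (SOME A. finite A \<and> card A = q \<and> A \<subseteq> integer_ring vabs L \<and>
     (\<forall>x\<in>integer_ring vabs L. \<exists>!d. d \<in> A \<and> vabs (x - d) < 1))"

lemma digits_spec: "finite digits \<and> card digits = q \<and> digits \<subseteq> integer_ring vabs L \<and>
     (\<forall>x\<in>integer_ring vabs L. \<exists>!d. d \<in> digits \<and> vabs (x - d) < 1)"
  unfolding digits_def
proof (rule someI_ex)
  let ?P = "\<lambda>A. finite A \<and> card A = q \<and> A \<subseteq> integer_ring vabs L \<and>
     (\<forall>x\<in>integer_ring vabs L. \<exists>!d. d \<in> A \<and> vabs (x - d) < 1)"
  show "\<exists>A. ?P A"
  proof (rule digits_exist)
    fix A assume "finite A" "card A = q" "A \<subseteq> integer_ring vabs L"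
      "\<And>x. x \<in> integer_ring vabs L \<Longrightarrow> \<exists>!d. d \<in> A \<and> vabs (x - d) < 1"
    hence "?P A" by (intro conjI ballI)
    thus "\<exists>A. ?P A" by (rule exI)
  qed
qed

lemma finite_digits: "finite digits" and card_digits: "card digits = q"
  and digits_L: "d \<in> digits \<Longrightarrow> d \<in> L" and digits_le_1: "d \<in> digits \<Longrightarrow> vabs d \<le> 1"
  using digits_spec unfolding integer_ring_def by blast+

lemma digit_exists:
  assumes "x \<in> L" "vabs x \<le> 1"
  obtains d where "d \<in> digits" "vabs (x - d) < 1"
proof -
  have "x \<in> integer_ring vabs L" using assms by (simp add: integer_ring_def)
  hence "\<exists>!d. d \<in> digits \<and> vabs (x - d) < 1" using digits_spec by blast
  thus ?thesis using that by blast
qed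

lemma digits_eqI:
  assumes "d \<in> digits" "d' \<in> digits" "vabs (d - d') < 1"
  shows "d = d'"
proof -
  have "d \<in> integer_ring vabs L" using assms digits_spec by blast
  hence "\<exists>!e. e \<in> digits \<and> vabs (d - e) < 1" using digits_spec by blast
  moreover have "vabs (d - d) < 1" by (simp add: vabs_0)
  ultimately show ?thesis using assms by blast
qed

text \<open>The leading digit of a unit must avoid the residue class of 0, the others are free. The
  test is on the absolute value because the digit representing that class need not be 0
  itself.\<close>

definition unit_digits :: "nat \<Rightarrow> 'k set" where
  "unit_digits i = (if i = 0 then {d \<in> digits. vabs d = 1} else digits)"

lemma unit_digits_subset: "unit_digits i \<subseteq> digits"
  by (auto simp: unit_digits_def)

lemma finite_unit_digits: "finite (unit_digits i)"
  using finite_subset[OF unit_digits_subset finite_digits] .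

lemma card_unit_digits_0: "card (unit_digits 0) = q - 1"
proof -
  obtain d where d: "d \<in> digits" "vabs (0 - d) < 1"
    using digit_exists[OF L_0] vabs_0 by (metis zero_le_one)
  have "digits - {d} = unit_digits 0"
  proof safe
    fix e assume e: "e \<in> digits" "e \<notin> unit_digits 0"
    hence "vabs e < 1" using digits_le_1[of e] by (auto simp: unit_digits_def)
    hence "vabs (e - d) < 1" using d(2) vabs_diff_less[of e 1 d] by (simp add: vabs_minus)
    thus "e = d" using digits_eqI e(1) d(1) by blast
  qed (use d in \<open>auto simp: unit_digits_def vabs_minus\<close>)
  hence "card (unit_digits 0) = card (digits - {d})" by simp
  also have "\<dots> = q - 1" using card_Diff_singleton[OF d(1)] card_digits by simp
  finally show ?thesis .
qed

lemma q_ge_2: "q \<ge> 2"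
proof -
  obtain d where d: "d \<in> digits" "vabs (1 - d) < 1"
    using digit_exists[OF L_1] vabs_1 by (metis order_refl)
  have "vabs d = 1"
  proof (rule ccontr)
    assume "vabs d \<noteq> 1"
    hence "vabs d < 1" using digits_le_1[OF d(1)] by simp
    from vabs_add_less[OF d(2) this] show False by (simp add: vabs_1)
  qed
  hence "d \<in> unit_digits 0" using d by (simp add: unit_digits_def)
  hence "card (unit_digits 0) > 0" using finite_unit_digits[of 0] by (auto simp: card_gt_0_iff)
  thus ?thesis unfolding card_unit_digits_0 by linarith
qed

lemma card_unit_digit_vectors: "card (PiE {..k} unit_digits) = (q - 1) * q ^ k"
proof -
  have "card (PiE {..k} unit_digits) = (\<Prod>i\<le>k. card (unit_digits i))"
    by (simp add: card_PiE)
  also have "\<dots> = card (unit_digits 0) * (\<Prod>i<k. card (unit_digits (Suc i)))"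
    by (simp add: prod.atMost_shift)
  also have "(\<Prod>i<k. card (unit_digits (Suc i))) = (\<Prod>i<k. q)"
    by (intro prod.cong) (simp_all only: unit_digits_def card_digits nat.distinct if_False)
  also have "\<dots> = q ^ k" by (simp only: prod_constant card_lessThan)
  finally show ?thesis by (simp only: card_unit_digits_0)
qed

definition expansion :: "(nat \<Rightarrow> 'k) \<Rightarrow> nat \<Rightarrow> 'k" where
  "expansion \<omega> k = (\<Sum>i\<le>k. \<omega> i * \<pi> ^ i)"

lemma expansion_cong: "(\<And>i. i \<le> k \<Longrightarrow> \<omega> i = \<omega>' i) \<Longrightarrow> expansion \<omega> k = expansion \<omega>' k"
  unfolding expansion_def by (rule sum.cong) auto

lemma expansion_L:
  assumes "\<And>i. i \<le> k \<Longrightarrow> \<omega> i \<in> unit_digits i"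
  shows "expansion \<omega> k \<in> L"
  unfolding expansion_def
proof (rule L_sum)
  fix i assume "i \<in> {..k}"
  hence "\<omega> i \<in> digits" using assms[of i] unit_digits_subset[of i] by auto
  thus "\<omega> i * \<pi> ^ i \<in> L" by (intro L_mult L_power uniformizer_L digits_L)
qed

lemma vabs_digit_mult_le: "d \<in> digits \<Longrightarrow> vabs (d * \<pi> ^ k) \<le> vabs \<pi> ^ k"
  unfolding vabs_mult vabs_power
  by (rule mult_left_le_one_le) (simp_all add: vabs_nonneg digits_le_1)

text \<open>By \<open>vabs_discrete\<close> an error below \<open>vabs \<pi> ^ k\<close> is
  divisible by \<open>\<pi> ^ Suc k\<close>, and the residue of the quotient is the next
  digit.\<close>

lemma expansion_approximates_unit:
  assumes "x \<in> unit_group vabs L"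
  obtains \<omega> where "\<omega> \<in> PiE {..k} unit_digits" "vabs (x - expansion \<omega> k) < vabs \<pi> ^ k"
proof -
  have x: "x \<in> L" "vabs x = 1" using assms by (auto simp: mem_unit_group_iff)
  have "\<exists>\<omega>. (\<forall>i\<le>k. \<omega> i \<in> unit_digits i) \<and> vabs (x - expansion \<omega> k) < vabs \<pi> ^ k"
  proof (induction k)
    case 0
    obtain d where d: "d \<in> digits" "vabs (x - d) < 1" using digit_exists[OF x(1)] x(2) by (metis order_refl)
    have "vabs d = 1"
    proof (rule ccontr)
      assume "vabs d \<noteq> 1"
      hence "vabs d < 1" using digits_le_1[OF d(1)] by simp
      from vabs_add_less[OF d(2) this] show False using x by simp
    qed
    thus ?case using d by (intro exI[of _ "\<lambda>_. d"]) (auto simp: unit_digits_def expansion_def)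
  next
    case (Suc k)
    then obtain \<omega> where \<omega>: "\<And>i. i \<le> k \<Longrightarrow> \<omega> i \<in> unit_digits i" "vabs (x - expansion \<omega> k) < vabs \<pi> ^ k"
      by blast
    define y where "y = (x - expansion \<omega> k) / \<pi> ^ Suc k"
    have yL: "y \<in> L" unfolding y_def
      using x \<omega> by (intro L_divide L_diff L_power uniformizer_L expansion_L) auto
    have "vabs (x - expansion \<omega> k) \<le> vabs \<pi> ^ Suc k"
      using x \<omega> by (intro vabs_discrete L_diff expansion_L) auto
    moreover have pos: "vabs \<pi> ^ Suc k > 0" using vabs_uniformizer_pos by simp
    ultimately have "vabs y \<le> 1"
      unfolding y_def divide_inverse vabs_mult vabs_inverse vabs_power by (simp add: field_simps)
    then obtain d where d: "d \<in> digits" "vabs (y - d) < 1" by (rule digit_exists[OF yL])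
    have "expansion (fun_upd \<omega> (Suc k) d) (Suc k) = expansion \<omega> k + d * \<pi> ^ Suc k"
      by (simp add: expansion_def)
    moreover have "x - (expansion \<omega> k + d * \<pi> ^ Suc k) = (y - d) * \<pi> ^ Suc k"
      using uniformizer_nonzero unfolding left_diff_distrib by (simp add: y_def)
    ultimately have "vabs (x - expansion (fun_upd \<omega> (Suc k) d) (Suc k)) = vabs (y - d) * vabs \<pi> ^ Suc k"
      by (simp only: vabs_mult vabs_power)
    also have "\<dots> < vabs \<pi> ^ Suc k" using mult_strict_right_mono[OF d(2) pos] by (simp only: mult_1)
    finally have "vabs (x - expansion (fun_upd \<omega> (Suc k) d) (Suc k)) < vabs \<pi> ^ Suc k" .
    moreover have "\<forall>i\<le>Suc k. (fun_upd \<omega> (Suc k) d) i \<in> unit_digits i"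
      using \<omega>(1) d(1) by (auto simp: le_Suc_eq) (simp add: unit_digits_def)
    ultimately show ?case by blast
  qed
  then obtain \<omega> where \<omega>: "\<forall>i\<le>k. \<omega> i \<in> unit_digits i" "vabs (x - expansion \<omega> k) < vabs \<pi> ^ k" by blast
  have "expansion (restrict \<omega> {..k}) k = expansion \<omega> k" by (rule expansion_cong) simp
  thus ?thesis using \<omega> by (intro that[of "restrict \<omega> {..k}"]) auto
qed

text \<open>Terms of index \<open>Suc k\<close> are smaller than \<open>vabs \<pi> ^ k\<close>, so
  closeness at one level implies closeness at the previous one. The induction hypothesis fixes the
  lower digits, and what remains is a single digit difference times
  \<open>\<pi> ^ Suc k\<close>.\<close>

lemma expansion_inject:
  assumes "\<And>i. i \<le> k \<Longrightarrow> \<omega> i \<in> unit_digits i" "\<And>i. i \<le> k \<Longrightarrow> \<omega>' i \<in> unit_digits i"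
    and "vabs (expansion \<omega> k - expansion \<omega>' k) < vabs \<pi> ^ k" and "i \<le> k"
  shows "\<omega> i = \<omega>' i"
  using assms
proof (induction k arbitrary: i)
  case 0
  have "\<omega> 0 \<in> digits" "\<omega>' 0 \<in> digits"
    using 0(1,2)[of 0] unit_digits_subset[of 0] by auto
  moreover have "vabs (\<omega> 0 - \<omega>' 0) < 1" using 0(3) by (simp add: expansion_def)
  ultimately have "\<omega> 0 = \<omega>' 0" by (rule digits_eqI)
  thus ?case using 0(4) by simp
next
  case (Suc k)
  let ?d = "\<omega> (Suc k)" and ?d' = "\<omega>' (Suc k)"
  have d: "?d \<in> digits" "?d' \<in> digits"
    using Suc.prems(1,2)[of "Suc k"] unit_digits_subset[of "Suc k"] by auto
  have e: "expansion \<omega> (Suc k) = expansion \<omega> k + ?d * \<pi> ^ Suc k"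
    "expansion \<omega>' (Suc k) = expansion \<omega>' k + ?d' * \<pi> ^ Suc k" by (simp_all add: expansion_def)
  have lt: "vabs \<pi> ^ Suc k < vabs \<pi> ^ k" using vabs_uniformizer_pos vabs_uniformizer_less_1 by simp
  have "vabs (?d * \<pi> ^ Suc k) < vabs \<pi> ^ k" "vabs (?d' * \<pi> ^ Suc k) < vabs \<pi> ^ k"
    using vabs_digit_mult_le[OF d(1), of "Suc k"] vabs_digit_mult_le[OF d(2), of "Suc k"] lt by linarith+
  hence 1: "vabs (?d * \<pi> ^ Suc k - ?d' * \<pi> ^ Suc k) < vabs \<pi> ^ k" by (rule vabs_diff_less)
  have 2: "vabs (expansion \<omega> (Suc k) - expansion \<omega>' (Suc k)) < vabs \<pi> ^ k"
    using Suc.prems(3) lt by linarith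
  have "vabs (expansion \<omega> k - expansion \<omega>' k) < vabs \<pi> ^ k"
    using vabs_diff_less[OF 2 1] by (simp add: e)
  hence IH: "\<omega> j = \<omega>' j" if "j \<le> k" for j using Suc.IH[of j] Suc.prems(1,2) that by simp
  hence "expansion \<omega> k = expansion \<omega>' k" by (rule expansion_cong)
  hence "expansion \<omega> (Suc k) - expansion \<omega>' (Suc k) = (?d - ?d') * \<pi> ^ Suc k"
    unfolding e by (simp add: left_diff_distrib)
  hence "vabs (?d - ?d') * vabs \<pi> ^ Suc k < 1 * vabs \<pi> ^ Suc k"
    using Suc.prems(3) by (simp only: vabs_mult vabs_power mult_1)
  hence "vabs (?d - ?d') < 1" by (rule mult_right_less_imp_less) (simp add: vabs_nonneg)
  hence "?d = ?d'" using digits_eqI d by blast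
  thus ?case using IH Suc.prems(4) by (cases "i = Suc k") auto
qed

text \<open>One further digit refines representatives modulo \<open>\<pi> ^ k\<close> to the next
  level. For large \<open>k\<close> they serve modulo \<open>p\<close> in the closedness
  proof.\<close>

lemma integer_ring_totally_bounded:
  obtains R where "finite R" "R \<subseteq> L" "\<And>x. x \<in> integer_ring vabs L \<Longrightarrow> \<exists>r\<in>R. vabs (x - r) \<le> vabs \<pi> ^ k"
proof -
  have "\<exists>R. finite R \<and> R \<subseteq> L \<and> (\<forall>x\<in>integer_ring vabs L. \<exists>r\<in>R. vabs (x - r) \<le> vabs \<pi> ^ k)"
  proof (induction k)
    case 0
    show ?case by (rule exI[of _ "{0}"]) (auto simp: L_0 integer_ring_def)
  next
    case (Suc k)
    then obtain R where R: "finite R" "R \<subseteq> L" "\<And>x. x \<in> integer_ring vabs L \<Longrightarrow> \<exists>r\<in>R. vabs (x - r) \<le> vabs \<pi> ^ k"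
      by blast
    let ?R = "(\<lambda>(r, d). r + d * \<pi> ^ k) ` (R \<times> digits)"
    have "\<exists>r\<in>?R. vabs (x - r) \<le> vabs \<pi> ^ Suc k" if x: "x \<in> integer_ring vabs L" for x
    proof -
      obtain r where r: "r \<in> R" "vabs (x - r) \<le> vabs \<pi> ^ k" using R(3)[OF x] by blast
      define y where "y = (x - r) / \<pi> ^ k"
      have xr: "x \<in> L" "r \<in> L" using x r R(2) by (auto simp: integer_ring_def)
      hence "y \<in> L" unfolding y_def by (intro L_divide L_diff L_power uniformizer_L)
      moreover have "vabs y \<le> 1" using r(2) vabs_uniformizer_pos
        unfolding y_def divide_inverse vabs_mult vabs_inverse vabs_power by (simp add: field_simps)
      ultimately obtain d where d: "d \<in> digits" "vabs (y - d) < 1" by (rule digit_exists)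
      have "x - (r + d * \<pi> ^ k) = (y - d) * \<pi> ^ k"
        using uniformizer_nonzero unfolding left_diff_distrib by (simp add: y_def)
      hence "vabs (x - (r + d * \<pi> ^ k)) = vabs (y - d) * vabs \<pi> ^ k"
        by (simp only: vabs_mult vabs_power)
      also have "\<dots> < vabs \<pi> ^ k"
        using d(2) vabs_uniformizer_pos mult_strict_right_mono[of "vabs (y - d)" 1 "vabs \<pi> ^ k"] by simp
      finally have "vabs (x - (r + d * \<pi> ^ k)) \<le> vabs \<pi> ^ Suc k"
        using xr digits_L[OF d(1)] by (intro vabs_discrete L_diff L_add L_mult L_power uniformizer_L)
      thus ?thesis using r(1) d(1) by force
    qed
    moreover have "?R \<subseteq> L" using R(2) digits_L by (auto intro!: L_add L_mult L_power uniformizer_L)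
    moreover have "finite ?R" using R(1) finite_digits by simp
    ultimately show ?case by blast
  qed
  thus ?thesis using that by blast
qed

text \<open>With \<open>R\<close> a finite set of representatives of \<open>O/pO\<close>, every point \<open>x\<close> of the closure of \<open>O\<close>
  has an expansion \<open>x = \<Sum>\<^sub>k r\<^sub>k p\<^sup>k\<close> with \<open>r\<^sub>k \<in> R\<close>. Collecting the terms with equal \<open>r\<^sub>k\<close> gives
  \<open>x = \<Sum>\<^sub>r c\<^sub>r r\<close> with \<open>c\<^sub>r \<in> \<rat>\<^sub>p\<close>.\<close>

lemma integer_ring_closed:
  assumes x: "\<And>e. e > 0 \<Longrightarrow> \<exists>y\<in>integer_ring vabs L. vabs (x - y) < e"
  shows "x \<in> L"
proof -
  let ?O = "integer_ring vabs L"
  define P where "P = real p"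
  have P: "P > 1" using prime_gt_1_nat[OF prime_p] by (simp add: P_def)
  have vp: "vabs (of_nat p) = 1 / P" by (simp add: vabs_p P_def)
  have p0: "(of_nat p :: 'k) \<noteq> 0" using prime_gt_0_nat[OF prime_p] by simp
  \<comment> \<open>\<open>C\<close> is the closure of the integer ring. The expansion has to run
    inside it because \<open>x\<close> is not yet known to lie in \<open>L\<close>.\<close>
  define C where "C = {x. \<forall>e>0. \<exists>y\<in>?O. vabs (x - y) < e}"
  have C1: "vabs x \<le> 1" if "x \<in> C" for x
  proof -
    have "\<exists>y\<in>?O. vabs (x - y) < 1" using that by (simp add: C_def)
    then obtain y where y: "y \<in> ?O" "vabs (x - y) < 1" by blast
    thus ?thesis using vabs_add_le_max[of "x - y" y] by (auto simp: integer_ring_def)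
  qed
  \<comment> \<open>For this \<open>k\<close>, congruence modulo \<open>\<pi> ^ k\<close> implies
    congruence modulo \<open>p\<close>. Dividing by the rational number \<open>p\<close> rather than
    by \<open>\<pi>\<close> is what makes the coefficients land in \<open>Qp\<close>.\<close>
  obtain k where k: "vabs \<pi> ^ k < 1 / P" using real_arch_pow_inv[of "1 / P" "vabs \<pi>"] P vabs_uniformizer_less_1 by auto
  obtain R where R: "finite R" "R \<subseteq> L"
    and R_pi: "\<And>x. x \<in> ?O \<Longrightarrow> \<exists>r\<in>R. vabs (x - r) \<le> vabs \<pi> ^ k"
    using integer_ring_totally_bounded[of k] by blast
  have R_dense: "\<exists>r\<in>R. vabs (x - r) \<le> 1 / P" if "x \<in> ?O" for x
    using R_pi[OF that] k by force
  have "\<exists>r\<in>R. (x - r) / of_nat p \<in> C" if x: "x \<in> C" for x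
  proof -
    have "\<exists>y\<in>?O. vabs (x - y) < 1 / P" using x P by (simp add: C_def)
    then obtain y where y: "y \<in> ?O" "vabs (x - y) < 1 / P" by blast
    obtain r where r: "r \<in> R" "vabs (y - r) \<le> 1 / P" using R_dense[OF y(1)] by blast
    have xr: "vabs (x - r) \<le> 1 / P" using vabs_diff_le_max[of x r y] y(2) r(2) by auto
    have "\<exists>z\<in>?O. vabs ((x - r) / of_nat p - z) < e" if e: "e > 0" for e
    proof -
      have "min (1 / P) (e / P) > 0" using P e by simp
      hence "\<exists>y'\<in>?O. vabs (x - y') < min (1 / P) (e / P)" using x unfolding C_def by blast
      then obtain y' where y': "y' \<in> ?O" "vabs (x - y') < 1 / P" "vabs (x - y') < e / P" by auto
      have "vabs (y' - r) \<le> 1 / P"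
        using vabs_diff_le_max[of y' r x] xr y'(2) vabs_minus_commute[of y' x] by auto
      hence "vabs ((y' - r) / of_nat p) \<le> 1"
        using P unfolding divide_inverse vabs_mult vabs_inverse vp by (simp add: field_simps)
      hence "(y' - r) / of_nat p \<in> ?O" using y'(1) r(1) R(2)
        by (auto simp: integer_ring_def intro!: L_divide L_diff L_of_nat)
      moreover have "(x - r) / of_nat p - (y' - r) / of_nat p = (x - y') * inverse (of_nat p)"
        using p0 by (simp add: field_simps)
      hence "vabs ((x - r) / of_nat p - (y' - r) / of_nat p) = vabs (x - y') * P"
        by (simp add: vabs_mult vabs_inverse vp)
      hence "vabs ((x - r) / of_nat p - (y' - r) / of_nat p) < e"
        using y'(3) P by (simp add: field_simps)
      ultimately show ?thesis by blast
    qed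
    thus ?thesis using r(1) by (auto simp: C_def)
  qed
  then obtain f where f: "\<And>x. x \<in> C \<Longrightarrow> f x \<in> R" "\<And>x. x \<in> C \<Longrightarrow> (x - f x) / of_nat p \<in> C"
    by (metis (no_types))
  define X where "X = rec_nat x (\<lambda>_ y. (y - f y) / of_nat p)"
  have X: "X 0 = x" "X (Suc n) = (X n - f (X n)) / of_nat p" for n by (simp_all add: X_def)
  have XC: "X n \<in> C" for n by (induction n) (use assms f(2) in \<open>auto simp: X, simp_all add: C_def\<close>)
  have x_eq: "x = (\<Sum>j<n. f (X j) * of_nat p ^ j) + of_nat p ^ n * X n" for n
  proof (induction n)
    case (Suc n)
    have "X n = f (X n) + of_nat p * X (Suc n)" using p0 by (simp add: X)
    hence "of_nat p ^ n * X n = of_nat p ^ n * (f (X n) + of_nat p * X (Suc n))" by (rule arg_cong)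
    also have "\<dots> = f (X n) * of_nat p ^ n + of_nat p ^ Suc n * X (Suc n)"
      by (simp add: algebra_simps)
    finally have "(\<Sum>j<n. f (X j) * of_nat p ^ j) + of_nat p ^ n * X n =
        (\<Sum>j<Suc n. f (X j) * of_nat p ^ j) + of_nat p ^ Suc n * X (Suc n)"
      by (simp only: sum.lessThan_Suc add.assoc)
    with Suc.IH show ?case by (rule trans)
  qed (simp add: X)
  \<comment> \<open>Partial sums of the coefficient of \<open>r\<close>: the powers of
    \<open>p\<close> whose digit is \<open>r\<close>. They are rational and converge to
    \<open>c r\<close>.\<close>
  define s where "s r n = (\<Sum>j<n. if f (X j) = r then of_nat p ^ j else 0 :: 'k)" for r n
  have dec: "(1 / P) ^ Suc n \<le> (1 / P) ^ n" for n using P by (intro power_decreasing) auto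
  have lim: "(\<lambda>n. (1 / P) ^ n) \<longlonglongrightarrow> 0" using P by (intro LIMSEQ_realpow_zero) auto
  have "\<exists>c. \<forall>n. vabs (c - s r n) \<le> (1 / P) ^ n" for r
  proof -
    have step: "vabs (s r (Suc n) - s r n) \<le> (1 / P) ^ n" for n
      using P by (simp add: s_def vabs_0 vabs_power vp)
    show ?thesis using ultrametric_limit[OF step dec lim] by blast
  qed
  then obtain c where c: "\<And>r n. vabs (c r - s r n) \<le> (1 / P) ^ n" by metis
  have "c r \<in> Qp vabs" for r
    unfolding mem_Qp_iff
  proof (intro allI impI)
    fix e :: real assume "e > 0"
    then obtain n where n: "(1 / P) ^ n < e" using real_arch_pow_inv[of e "1 / P"] P by auto
    have "s r n \<in> \<rat>" unfolding s_def by (intro Rats_sum) auto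
    thus "\<exists>y\<in>\<rat>. vabs (c r - y) < e" using c[of r n] n by (intro bexI[of _ "s r n"]) auto
  qed
  hence cL: "c r \<in> L" for r using Qp_subset_L by blast
  \<comment> \<open>Members of \<open>R\<close> are only known to lie in \<open>L\<close>. Those
    occurring as digits satisfy \<open>f (X n) = X n - p * X (Suc n)\<close>, which bounds them by
    1; hence the restriction to \<open>R'\<close>.\<close>
  have R1: "vabs r \<le> 1" if rR: "r \<in> R \<inter> range (\<lambda>n. f (X n))" for r
  proof -
    obtain n where r: "r = f (X n)" using rR by blast
    have "f (X n) = X n - of_nat p * X (Suc n)" using p0 by (simp add: X)
    moreover have "vabs (of_nat p * X (Suc n)) \<le> 1"
      using C1[OF XC[of "Suc n"]] vabs_p_less_1 vabs_nonneg[of "of_nat p"] vabs_nonneg[of "X (Suc n)"]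
      by (simp add: vabs_mult mult_le_one)
    ultimately show ?thesis using C1[OF XC[of n]] vabs_add_le_max[of "X n" "- (of_nat p * X (Suc n))"] r
      by (auto simp: vabs_minus)
  qed
  define R' where "R' = R \<inter> range (\<lambda>n. f (X n))"
  have finR': "finite R'" using R(1) by (simp add: R'_def)
  define x' where "x' = (\<Sum>r\<in>R'. c r * r)"
  have x'L: "x' \<in> L" unfolding x'_def R'_def using cL R(2) by (intro L_sum L_mult) auto
  have "vabs (x - x') \<le> (1 / P) ^ n" for n
  proof -
    have "(\<Sum>r\<in>R'. s r n * r) = (\<Sum>j<n. \<Sum>r\<in>R'. (if f (X j) = r then of_nat p ^ j else 0) * r)"
      unfolding s_def sum_distrib_right by (rule sum.swap)
    also have "\<dots> = (\<Sum>j<n. f (X j) * of_nat p ^ j)"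
    proof (rule sum.cong[OF refl])
      fix j
      have R': "f (X j) \<in> R'" using f(1)[OF XC] by (auto simp: R'_def)
      have "(\<Sum>r\<in>R'. (if f (X j) = r then of_nat p ^ j else 0) * r) =
          (\<Sum>r\<in>R'. if f (X j) = r then f (X j) * of_nat p ^ j else 0)"
        by (rule sum.cong) auto
      also have "\<dots> = f (X j) * of_nat p ^ j" using finR' R' by (simp add: sum.delta')
      finally show "(\<Sum>r\<in>R'. (if f (X j) = r then of_nat p ^ j else 0) * r) = f (X j) * of_nat p ^ j" .
    qed
    finally have e: "x - x' = of_nat p ^ n * X n + (\<Sum>r\<in>R'. (s r n - c r) * r)"
      using x_eq[of n] by (simp add: x'_def left_diff_distrib sum_subtractf)
    have Pn: "0 \<le> (1 / P) ^ n" using P by simp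
    have "vabs (of_nat p ^ n * X n) \<le> (1 / P) ^ n"
      using mult_left_le[OF C1[OF XC[of n]] Pn] by (simp add: vabs_mult vabs_power vp)
    moreover have "vabs (\<Sum>r\<in>R'. (s r n - c r) * r) \<le> (1 / P) ^ n"
    proof (rule vabs_sum_le[OF Pn])
      fix r assume "r \<in> R'"
      hence r1: "vabs r \<le> 1" using R1 by (simp add: R'_def)
      show "vabs ((s r n - c r) * r) \<le> (1 / P) ^ n"
        using mult_left_le[OF r1 vabs_nonneg[of "s r n - c r"]] c[of r n] vabs_minus_commute[of "c r" "s r n"]
        by (simp add: vabs_mult)
    qed
    ultimately show ?thesis unfolding e by (intro order_trans[OF vabs_add_le_max]) simp
  qed
  hence "vabs (x - x') \<le> 0" by (intro LIMSEQ_le_const[OF lim] exI[of _ 0]) blast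
  hence "x = x'" using vabs_nonneg[of "x - x'"] vabs_eq_0_iff[of "x - x'"] by auto
  thus ?thesis using x'L by simp
qed

text \<open>The first omitted term has index \<open>Suc k\<close>, whence the radius. The limit
  exists in the ambient field, closedness of the integer ring brings it back into \<open>L\<close>,
  and the leading digit fixes its absolute value.\<close>

lemma expansion_converges:
  assumes \<omega>: "\<And>i. \<omega> i \<in> unit_digits i"
  obtains x where "x \<in> unit_group vabs L" "\<And>k. vabs (x - expansion \<omega> k) \<le> vabs \<pi> ^ Suc k"
proof -
  have d: "\<omega> i \<in> digits" for i using \<omega> unit_digits_subset by blast
  have step: "vabs (expansion \<omega> (Suc k) - expansion \<omega> k) \<le> vabs \<pi> ^ Suc k" for k
    using vabs_digit_mult_le[OF d[of "Suc k"], of "Suc k"] by (simp add: expansion_def)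
  have lim: "(\<lambda>k. vabs \<pi> ^ Suc k) \<longlonglongrightarrow> 0"
    using vabs_uniformizer_pos vabs_uniformizer_less_1 by (intro LIMSEQ_Suc LIMSEQ_realpow_zero) auto
  have dec: "vabs \<pi> ^ Suc (Suc k) \<le> vabs \<pi> ^ Suc k" for k by (rule uniformizer_power_le) simp
  obtain x where x: "\<And>k. vabs (x - expansion \<omega> k) \<le> vabs \<pi> ^ Suc k"
    using ultrametric_limit[OF step dec lim] by blast
  have int: "expansion \<omega> k \<in> integer_ring vabs L" for k
  proof -
    have "vabs (\<omega> i * \<pi> ^ i) \<le> 1" for i
      using vabs_digit_mult_le[OF d[of i], of i] uniformizer_power_le[of 0 i] by simp
    hence "vabs (expansion \<omega> k) \<le> 1" unfolding expansion_def by (intro vabs_sum_le) auto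
    thus ?thesis using expansion_L[of k \<omega>] \<omega> by (simp add: integer_ring_def)
  qed
  have "x \<in> L"
  proof (rule integer_ring_closed)
    fix e :: real assume "e > 0"
    then obtain k where k: "vabs \<pi> ^ k < e"
      using real_arch_pow_inv[of e "vabs \<pi>"] vabs_uniformizer_less_1 by auto
    have "vabs (x - expansion \<omega> k) < e" using x[of k] k uniformizer_power_le[of k "Suc k"] by auto
    thus "\<exists>y\<in>integer_ring vabs L. vabs (x - y) < e" using int by blast
  qed
  moreover have "vabs x = 1"
  proof -
    have w: "vabs (\<omega> 0) = 1" using \<omega>[of 0] by (simp add: unit_digits_def)
    have "vabs (x - \<omega> 0) < 1" using x[of 0] vabs_uniformizer_less_1 by (simp add: expansion_def)
    thus ?thesis using vabs_diff_eq_max[of x "\<omega> 0" 0] w by simp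
  qed
  ultimately show ?thesis using x by (intro that[of x]) (auto simp: mem_unit_group_iff)
qed

end

subsection \<open>Residue classes and the lower bound for the energy\<close>

text \<open>Cauchy-Schwarz in tangent form: the square lies above its tangent at
  \<open>1 / c\<close>, the value of equal masses.\<close>

lemma sum_power2_ge_inverse_card:
  fixes m :: "'a \<Rightarrow> real"
  assumes "finite I" "I \<noteq> {}" "1 \<le> (\<Sum>i\<in>I. m i)"
  shows "1 / card I \<le> (\<Sum>i\<in>I. (m i)\<^sup>2)"
proof -
  define c where "c = real (card I)"
  have c: "c > 0" using assms by (simp add: c_def card_gt_0_iff)
  have "2 / c * m i - 1 / c\<^sup>2 \<le> (m i)\<^sup>2" for i
    using zero_le_power2[of "m i - 1 / c"] by (simp add: power2_diff power_divide)
  hence "(\<Sum>i\<in>I. 2 / c * m i - 1 / c\<^sup>2) \<le> (\<Sum>i\<in>I. (m i)\<^sup>2)" by (rule sum_mono)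
  also have "(\<Sum>i\<in>I. 2 / c * m i - 1 / c\<^sup>2) = 2 / c * (\<Sum>i\<in>I. m i) - 1 / c"
    using c by (simp add: sum_subtractf sum_distrib_left c_def power2_eq_square)
  finally show ?thesis
    using mult_left_mono[OF assms(3), of "2 / c"] c by (simp add: c_def)
qed

lemma neg_log_ge:
  assumes "0 \<le> t" "t \<le> s" "0 < s" "r \<le> - ln s"
  shows "ennreal r \<le> neg_log t"
proof (cases "t = 0")
  case False
  hence "ln t \<le> ln s" using assms by simp
  hence "r \<le> - ln t" using assms(4) by linarith
  thus ?thesis using False by (simp add: neg_log_def ennreal_leI)
qed (simp add: neg_log_def)

lemma openin_imp_berk_borel: "openin (berk_P1 vabs) U \<Longrightarrow> U \<in> sets (berk_borel vabs)"
  unfolding berk_borel_def by (subst sets_measure_of) (auto dest: openin_subset)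

context padic_local_field
begin

section \<open>Counting the levels at which two units agree\<close>

definition log_gap :: real where "log_gap = - ln (vabs \<pi>)"

lemma log_gap_pos: "log_gap > 0"
  using vabs_uniformizer_pos vabs_uniformizer_less_1 by (simp add: log_gap_def)

lemma uniformizer_power_less: "j < k \<Longrightarrow> vabs \<pi> ^ k < vabs \<pi> ^ j"
  using vabs_uniformizer_pos vabs_uniformizer_less_1 by (simp add: power_strict_decreasing)

lemma uniformizer_power_pos: "0 < vabs \<pi> ^ k"
  using vabs_uniformizer_pos by simp

lemma ln_uniformizer_power: "- ln (vabs \<pi> ^ k) = real k * log_gap"
  using vabs_uniformizer_pos by (simp add: log_gap_def ln_realpow)

text \<open>If level \<open>N\<close> is counted, discreteness gives
  \<open>vabs x \<le> vabs \<pi> ^ Suc N\<close>, so the maximum is that power and the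
  \<open>Suc N\<close> levels contribute at most its negative logarithm; otherwise the maximum stays
  at \<open>vabs x\<close> and nothing is added.\<close>

lemma sum_levels_le:
  assumes "x \<in> L" "vabs x \<le> 1"
  shows "(\<Sum>k<N. if vabs x < vabs \<pi> ^ k then log_gap else 0) \<le> - ln (max (vabs x) (vabs \<pi> ^ N))"
proof (induction N)
  case 0
  show ?case using assms(2) by (simp add: max_absorb2)
next
  case (Suc N)
  show ?case
  proof (cases "vabs x < vabs \<pi> ^ N")
    case True
    have "(\<Sum>k<Suc N. if vabs x < vabs \<pi> ^ k then log_gap else 0) \<le> (\<Sum>k<Suc N. log_gap)"
      using log_gap_pos by (intro sum_mono) auto
    also have "\<dots> = - ln (vabs \<pi> ^ Suc N)" unfolding ln_uniformizer_power by simp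
    also have "vabs \<pi> ^ Suc N = max (vabs x) (vabs \<pi> ^ Suc N)"
      using vabs_discrete[OF assms(1) True] by (rule max_absorb2[symmetric])
    finally show ?thesis .
  next
    case False
    hence "max (vabs x) (vabs \<pi> ^ N) = vabs x" "max (vabs x) (vabs \<pi> ^ Suc N) = vabs x"
      using uniformizer_power_less[of N "Suc N"] by (auto simp: max_def)
    thus ?thesis using Suc False by simp
  qed
qed

text \<open>Converse estimate with all levels, for the upper bound on the energy. The first level
  \<open>m\<close> not counted has \<open>vabs \<pi> ^ m \<le> vabs x\<close>; for
  \<open>x = 0\<close> there is none, and the series diverges like the kernel.\<close>

lemma neg_log_le_sum_levels:
  "neg_log (vabs x) \<le> (\<Sum>k. ennreal (if vabs x < vabs \<pi> ^ k then log_gap else 0))"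
  (is "_ \<le> ?S")
proof -
  have part: "ennreal (real m * log_gap) \<le> ?S" if "\<And>k. k < m \<Longrightarrow> vabs x < vabs \<pi> ^ k" for m
  proof -
    have "ennreal (real m * log_gap) = (\<Sum>k<m. ennreal (if vabs x < vabs \<pi> ^ k then log_gap else 0))"
      using that log_gap_pos by (simp add: ennreal_mult ennreal_of_nat_eq_real_of_nat)
    also have "\<dots> \<le> ?S" by (rule sum_le_suminf) auto
    finally show ?thesis .
  qed
  show ?thesis
  proof (cases "x = 0")
    case True
    hence all: "ennreal (real m * log_gap) \<le> ?S" for m
      using part[of m] uniformizer_power_pos by (simp add: vabs_0)
    have "?S = \<top>"
    proof (rule ccontr)
      assume "?S \<noteq> \<top>"
      then obtain s where s: "?S = ennreal s" "s \<ge> 0" by (cases ?S) auto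
      obtain m where "s < real m * log_gap" using reals_Archimedean3[OF log_gap_pos] by blast
      thus False using all[of m] s by (simp add: ennreal_le_iff)
    qed
    thus ?thesis by simp
  next
    case False
    hence x: "vabs x > 0" using vabs_nonneg[of x] vabs_eq_0_iff[of x] by linarith
    obtain k where k: "vabs \<pi> ^ k < vabs x"
      using real_arch_pow_inv[OF x vabs_uniformizer_less_1] by blast
    define m where "m = (LEAST k. \<not> vabs x < vabs \<pi> ^ k)"
    have "\<not> vabs x < vabs \<pi> ^ m" unfolding m_def by (rule LeastI[of _ k]) (use k in simp)
    hence "ln (vabs \<pi> ^ m) \<le> ln (vabs x)" using uniformizer_power_pos[of m] x by simp
    hence "- ln (vabs x) \<le> real m * log_gap" using ln_uniformizer_power[of m] by linarith
    hence "neg_log (vabs x) \<le> ennreal (real m * log_gap)" using x by (simp add: neg_log_def ennreal_leI)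
    also have "\<dots> \<le> ?S" using part[of m] not_less_Least[of _ "\<lambda>k. \<not> vabs x < vabs \<pi> ^ k"]
      unfolding m_def by blast
    finally show ?thesis .
  qed
qed

text \<open>The Berkovich open disc about \<open>y\<close>, described by the value at
  \<open>T - y\<close>. The strict inequality makes it open, hence Borel; between units of
  \<open>L\<close> it means congruence modulo \<open>\<pi> ^ (k + 1)\<close>.\<close>

definition residue_disc :: "'k \<Rightarrow> nat \<Rightarrow> 'k berk set" where
  "residue_disc y k = Some ` {\<nu> \<in> mult_seminorms vabs. \<nu> [:- y, 1:] < vabs \<pi> ^ k}"

lemma residue_disc_sets: "residue_disc y k \<in> sets (berk_borel vabs)"
proof (rule openin_imp_berk_borel)
  let ?V = "{\<nu> \<in> topspace (powertop_real UNIV). \<nu> [:- y, 1:] \<in> {..<vabs \<pi> ^ k}}"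
  have "openin (powertop_real UNIV) ?V"
    by (rule openin_continuous_map_preimage[where Y = euclideanreal])
       (auto intro!: continuous_map_product_projection)
  hence "openin (subtopology (powertop_real UNIV) (mult_seminorms vabs)) (?V \<inter> mult_seminorms vabs)"
    unfolding openin_subtopology by blast
  moreover have "?V \<inter> mult_seminorms vabs = {\<nu> \<in> mult_seminorms vabs. \<nu> [:- y, 1:] < vabs \<pi> ^ k}"
    by auto
  ultimately show "openin (berk_P1 vabs) (residue_disc y k)"
    unfolding berk_P1_def residue_disc_def openin_Alexandroff_compactification_image_Some by simp
qed

lemma disc_point_in_residue_disc_iff:
  assumes "0 \<le> \<eta>"
  shows "disc_point vabs x \<eta> \<in> residue_disc y k \<longleftrightarrow> max (vabs (x - y)) \<eta> < vabs \<pi> ^ k"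
  using D_mult_seminorms[OF assms, of x] D_linear[OF assms, of x y]
  by (auto simp: residue_disc_def disc_point_def)

abbreviation digit_vectors :: "nat \<Rightarrow> (nat \<Rightarrow> 'k) set" where
  "digit_vectors k \<equiv> PiE {..k} unit_digits"

lemma finite_digit_vectors: "finite (digit_vectors k)"
  by (intro finite_PiE) (auto simp: finite_unit_digits)

lemma vabs_unit: "x \<in> unit_group vabs L \<Longrightarrow> vabs x = 1"
  and unit_L: "x \<in> unit_group vabs L \<Longrightarrow> x \<in> L"
  by (auto simp: mem_unit_group_iff)

lemma residue_disc_digits_unique:
  assumes "\<omega> \<in> digit_vectors k" "\<omega>' \<in> digit_vectors k"
    and "vabs (x - expansion \<omega> k) < vabs \<pi> ^ k" "vabs (x - expansion \<omega>' k) < vabs \<pi> ^ k"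
  shows "\<omega> = \<omega>'"
proof (rule PiE_ext[OF assms(1,2)])
  fix i assume i: "i \<in> {..k}"
  have "vabs (expansion \<omega> k - expansion \<omega>' k) < vabs \<pi> ^ k"
    using vabs_diff_less[OF assms(4,3)] by simp
  thus "\<omega> i = \<omega>' i" using assms(1,2) i by (intro expansion_inject[of k]) (auto simp: PiE_iff)
qed

text \<open>Measurable stand-in for the level \<open>k\<close> part of \<open>-log \<delta>\<close>:
  its double integral is \<open>log_gap\<close> times the sum of the squared class masses.\<close>

definition class_kernel :: "nat \<Rightarrow> 'k berk \<Rightarrow> 'k berk \<Rightarrow> ennreal" where
  "class_kernel k \<zeta> \<xi> = (\<Sum>\<omega>\<in>digit_vectors k. ennreal log_gap *
     (indicator (residue_disc (expansion \<omega> k) k) \<zeta> * indicator (residue_disc (expansion \<omega> k) k) \<xi>))"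

text \<open>Ultrametric discs of equal radius with a common point coincide, so at most the summand
  of the class of \<open>x\<close> survives. A radius of \<open>vabs \<pi> ^ k\<close> or more
  removes that one as well, hence only an inequality.\<close>

lemma class_kernel_le:
  assumes x: "x \<in> unit_group vabs L" and \<eta>: "0 \<le> \<eta>" and \<eta>': "0 \<le> \<eta>'"
  shows "class_kernel k (disc_point vabs x \<eta>) (disc_point vabs x' \<eta>')
    \<le> ennreal (if vabs (x - x') < vabs \<pi> ^ k then log_gap else 0)"
proof -
  obtain \<omega>0 where \<omega>0: "\<omega>0 \<in> digit_vectors k" "vabs (x - expansion \<omega>0 k) < vabs \<pi> ^ k"
    using expansion_approximates_unit[OF x] by blast
  have term_le: "ennreal log_gap * (indicator (residue_disc (expansion \<omega> k) k) (disc_point vabs x \<eta>) *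
        indicator (residue_disc (expansion \<omega> k) k) (disc_point vabs x' \<eta>'))
      \<le> (if \<omega> = \<omega>0 then ennreal (if vabs (x - x') < vabs \<pi> ^ k then log_gap else 0) else 0)"
    (is "?t \<omega> \<le> _") if \<omega>: "\<omega> \<in> digit_vectors k" for \<omega>
  proof (cases "disc_point vabs x \<eta> \<in> residue_disc (expansion \<omega> k) k \<and>
      disc_point vabs x' \<eta>' \<in> residue_disc (expansion \<omega> k) k")
    case True
    hence 1: "vabs (x - expansion \<omega> k) < vabs \<pi> ^ k" and 2: "vabs (x' - expansion \<omega> k) < vabs \<pi> ^ k"
      using \<eta> \<eta>' by (auto simp: disc_point_in_residue_disc_iff)
    have "\<omega> = \<omega>0" using residue_disc_digits_unique[OF \<omega> \<omega>0(1) 1 \<omega>0(2)] .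
    moreover have "vabs (x - x') < vabs \<pi> ^ k" using vabs_diff_less[OF 1 2] by simp
    ultimately show ?thesis using True by simp
  next
    case False
    thus ?thesis by (auto simp: indicator_def)
  qed
  have "class_kernel k (disc_point vabs x \<eta>) (disc_point vabs x' \<eta>') \<le>
      (\<Sum>\<omega>\<in>digit_vectors k. if \<omega> = \<omega>0 then ennreal (if vabs (x - x') < vabs \<pi> ^ k then log_gap else 0) else 0)"
    unfolding class_kernel_def by (rule sum_mono) (rule term_le)
  also have "\<dots> = ennreal (if vabs (x - x') < vabs \<pi> ^ k then log_gap else 0)"
    using \<omega>0(1) finite_digit_vectors by (subst sum.delta) auto
  finally show ?thesis .
qed

lemma class_kernel_le_neg_log_hsia:
  assumes x: "x \<in> unit_group vabs L" "x' \<in> unit_group vabs L"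
    and \<eta>: "0 \<le> \<eta>" "\<eta> \<le> vabs \<pi> ^ N" "0 \<le> \<eta>'" "\<eta>' \<le> vabs \<pi> ^ N"
  shows "(\<Sum>k<N. class_kernel k (disc_point vabs x \<eta>) (disc_point vabs x' \<eta>'))
    \<le> neg_log (hsia vabs (disc_point vabs x \<eta>) (disc_point vabs x' \<eta>'))"
proof -
  have v: "vabs x = 1" "vabs x' = 1" "x - x' \<in> L" using x by (auto simp: vabs_unit unit_L L_diff)
  have le1: "vabs \<pi> ^ N \<le> 1" using uniformizer_power_le[of 0 N] by simp
  have d1: "vabs (x - x') \<le> 1" using vabs_add_le_max[of x "- x'"] v by (simp add: vabs_minus)
  have hsia: "hsia vabs (disc_point vabs x \<eta>) (disc_point vabs x' \<eta>') = max (vabs (x - x')) (max \<eta> \<eta>')"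
    using v \<eta> le1 by (intro hsia_disc_points) auto
  have "(\<Sum>k<N. class_kernel k (disc_point vabs x \<eta>) (disc_point vabs x' \<eta>'))
      \<le> (\<Sum>k<N. ennreal (if vabs (x - x') < vabs \<pi> ^ k then log_gap else 0))"
    using class_kernel_le x \<eta> by (intro sum_mono) auto
  also have "\<dots> = ennreal (\<Sum>k<N. if vabs (x - x') < vabs \<pi> ^ k then log_gap else 0)"
    using log_gap_pos by (intro sum_ennreal) auto
  also have "\<dots> \<le> neg_log (max (vabs (x - x')) (max \<eta> \<eta>'))"
  proof (rule neg_log_ge)
    show "(\<Sum>k<N. if vabs (x - x') < vabs \<pi> ^ k then log_gap else 0) \<le> - ln (max (vabs (x - x')) (vabs \<pi> ^ N))"
      by (rule sum_levels_le[OF v(3) d1])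
    show "max (vabs (x - x')) (max \<eta> \<eta>') \<le> max (vabs (x - x')) (vabs \<pi> ^ N)" using \<eta> by auto
    show "0 < max (vabs (x - x')) (vabs \<pi> ^ N)" using uniformizer_power_pos[of N] by (simp add: less_max_iff_disj)
    show "0 \<le> max (vabs (x - x')) (max \<eta> \<eta>')" using vabs_nonneg[of "x - x'"] by (simp add: le_max_iff_disj)
  qed
  finally show ?thesis unfolding hsia .
qed

definition class_mass :: "nat \<Rightarrow> real" where
  "class_mass k = 1 / ((real q - 1) * real q ^ k)"

lemma class_mass_eq: "class_mass k = 1 / real (card (digit_vectors k))"
  using q_ge_2 unfolding class_mass_def card_unit_digit_vectors
  by (simp only: of_nat_mult of_nat_power of_nat_diff[of 1 q]) (simp add: of_nat_diff)

lemma class_mass_nonneg: "0 \<le> class_mass k"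
  by (simp add: class_mass_eq)

text \<open>The class kernels lie below the kernel on \<open>E \<times> E\<close>, and their
  integrals are sums of squares, to which the tangent form of Cauchy-Schwarz applies.\<close>

lemma energy_lower_bound:
  assumes \<nu>: "\<nu> \<in> prob_measures_on vabs E"
    and E: "\<And>\<zeta>. \<zeta> \<in> E \<Longrightarrow> \<exists>x\<in>unit_group vabs L. \<exists>\<eta>. 0 \<le> \<eta> \<and> \<eta> \<le> vabs \<pi> ^ N \<and> \<zeta> = disc_point vabs x \<eta>"
  shows "ennreal (\<Sum>k<N. log_gap * class_mass k) \<le> energy vabs \<nu>"
proof -
  interpret prob_space \<nu> using \<nu> by (simp add: prob_measures_on_def)
  have sets: "sets \<nu> = sets (berk_borel vabs)" and AE_E: "AE \<zeta> in \<nu>. \<zeta> \<in> E"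
    using \<nu> by (auto simp: prob_measures_on_def)
  let ?U = "\<lambda>k \<omega>. residue_disc (expansion \<omega> k) k"
  have U: "?U k \<omega> \<in> sets \<nu>" for k \<omega> by (simp add: sets residue_disc_sets)
  \<comment> \<open>Since \<open>k < N\<close>, a radius of at most \<open>vabs \<pi> ^ N\<close> is
    strictly below \<open>vabs \<pi> ^ k\<close>, so each point of \<open>E\<close> lies in a class.
    The masses then sum to at least 1.\<close>
  have mass: "class_mass k \<le> (\<Sum>\<omega>\<in>digit_vectors k. (measure \<nu> (?U k \<omega>))\<^sup>2)" if k: "k < N" for k
  proof -
    have "AE \<zeta> in \<nu>. \<zeta> \<in> (\<Union>\<omega>\<in>digit_vectors k. ?U k \<omega>)"
      using AE_E
    proof (rule AE_mp, intro AE_I2 impI)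
      fix \<zeta> assume "\<zeta> \<in> E"
      then obtain x \<eta> where x: "x \<in> unit_group vabs L" "0 \<le> \<eta>" "\<eta> \<le> vabs \<pi> ^ N" "\<zeta> = disc_point vabs x \<eta>"
        using E by blast
      obtain \<omega> where "\<omega> \<in> digit_vectors k" "vabs (x - expansion \<omega> k) < vabs \<pi> ^ k"
        using expansion_approximates_unit[OF x(1)] by blast
      thus "\<zeta> \<in> (\<Union>\<omega>\<in>digit_vectors k. ?U k \<omega>)"
        using x uniformizer_power_less[OF k] by (auto simp: disc_point_in_residue_disc_iff)
    qed
    moreover have "(\<Union>\<omega>\<in>digit_vectors k. ?U k \<omega>) \<in> sets \<nu>"
      using U finite_digit_vectors by (intro sets.finite_UN) auto
    ultimately have "1 = measure \<nu> (\<Union>\<omega>\<in>digit_vectors k. ?U k \<omega>)"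
      by (subst (asm) prob_eq_1[symmetric]) simp_all
    also have "\<dots> \<le> (\<Sum>\<omega>\<in>digit_vectors k. measure \<nu> (?U k \<omega>))"
      using U finite_digit_vectors by (intro measure_UNION_le) auto
    finally have "1 \<le> (\<Sum>\<omega>\<in>digit_vectors k. measure \<nu> (?U k \<omega>))" .
    moreover from this have "digit_vectors k \<noteq> {}" by auto
    ultimately show ?thesis
      unfolding class_mass_eq by (intro sum_power2_ge_inverse_card finite_digit_vectors)
  qed
  have inner: "(\<integral>\<^sup>+ \<xi>. (\<Sum>k<N. class_kernel k \<zeta> \<xi>) \<partial>\<nu>) =
      (\<Sum>k<N. \<Sum>\<omega>\<in>digit_vectors k. ennreal log_gap * (indicator (?U k \<omega>) \<zeta> * emeasure \<nu> (?U k \<omega>)))" for \<zeta>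
    unfolding class_kernel_def using U
    by (simp add: nn_integral_sum nn_integral_cmult)
  have "ennreal (\<Sum>k<N. log_gap * class_mass k)
      \<le> ennreal (\<Sum>k<N. log_gap * (\<Sum>\<omega>\<in>digit_vectors k. (measure \<nu> (?U k \<omega>))\<^sup>2))"
    using mass log_gap_pos by (intro ennreal_leI sum_mono mult_left_mono) auto
  also have "\<dots> = (\<Sum>k<N. \<Sum>\<omega>\<in>digit_vectors k. ennreal log_gap * (emeasure \<nu> (?U k \<omega>) * emeasure \<nu> (?U k \<omega>)))"
    using log_gap_pos
    by (simp add: sum_nonneg emeasure_eq_measure sum_distrib_left power2_eq_square
        flip: sum_ennreal ennreal_mult)
  also have "\<dots> = (\<integral>\<^sup>+ \<zeta>. (\<integral>\<^sup>+ \<xi>. (\<Sum>k<N. class_kernel k \<zeta> \<xi>) \<partial>\<nu>) \<partial>\<nu>)"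
    unfolding inner using U
    by (simp add: nn_integral_sum nn_integral_cmult nn_integral_multc)
  also have "\<dots> \<le> energy vabs \<nu>"
    unfolding energy_def
  proof (rule nn_integral_mono_AE, rule AE_mp[OF AE_E], intro AE_I2 impI)
    fix \<zeta> assume \<zeta>: "\<zeta> \<in> E"
    show "(\<integral>\<^sup>+ \<xi>. (\<Sum>k<N. class_kernel k \<zeta> \<xi>) \<partial>\<nu>) \<le> (\<integral>\<^sup>+ \<xi>. neg_log (hsia vabs \<zeta> \<xi>) \<partial>\<nu>)"
    proof (rule nn_integral_mono_AE, rule AE_mp[OF AE_E], intro AE_I2 impI)
      fix \<xi> assume "\<xi> \<in> E"
      then obtain x' \<eta>' where "x' \<in> unit_group vabs L" "0 \<le> \<eta>'" "\<eta>' \<le> vabs \<pi> ^ N" "\<xi> = disc_point vabs x' \<eta>'"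
        using E by blast
      moreover obtain x \<eta> where "x \<in> unit_group vabs L" "0 \<le> \<eta>" "\<eta> \<le> vabs \<pi> ^ N" "\<zeta> = disc_point vabs x \<eta>"
        using E[OF \<zeta>] by blast
      ultimately show "(\<Sum>k<N. class_kernel k \<zeta> \<xi>) \<le> neg_log (hsia vabs \<zeta> \<xi>)"
        using class_kernel_le_neg_log_hsia by simp
    qed
  qed
  finally show ?thesis .
qed

subsection \<open>The Haar measure on the units\<close>

text \<open>The class centres of the various levels are not assumed nested, but \<open>\<nu>\<close>
  links them: by the triangle inequality they form a Cauchy sequence, and \<open>\<nu>\<close>
  vanishes on \<open>T - y\<close> for their limit \<open>y\<close>.\<close>

lemma seminorm_in_all_classes:
  assumes \<nu>: "\<nu> \<in> mult_seminorms vabs"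
    and cls: "\<And>k. \<exists>\<omega>\<in>digit_vectors k. \<nu> [:- expansion \<omega> k, 1:] < vabs \<pi> ^ k"
  shows "\<exists>y\<in>unit_group vabs L. \<nu> = D y 0"
proof -
  have add: "\<nu> (f + g) \<le> \<nu> f + \<nu> g" and const: "\<nu> [:c:] = vabs c" and mult: "\<nu> (f * g) = \<nu> f * \<nu> g"
    and nonneg: "0 \<le> \<nu> f" for f g c
    using \<nu> by (auto simp: mult_seminorms_def)
  obtain \<omega> where \<omega>: "\<And>k. \<omega> k \<in> digit_vectors k" "\<And>k. \<nu> [:- expansion (\<omega> k) k, 1:] < vabs \<pi> ^ k"
    using cls by metis
  define s where "s k = expansion (\<omega> k) k" for k
  have s: "\<nu> [:- s k, 1:] < vabs \<pi> ^ k" for k using \<omega>(2) by (simp add: s_def)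
  have neg: "\<nu> [:c, - 1:] = \<nu> [:- c, 1:]" for c
    using mult[of "[:- 1:]" "[:- c, 1:]"] const[of "- 1"] by (simp add: vabs_minus vabs_1)
  have dist: "vabs (a - b) \<le> \<nu> [:- a, 1:] + \<nu> [:- b, 1:]" for a b
    using add[of "[:a, - 1:]" "[:- b, 1:]"] const[of "a - b"] neg[of a] by simp
  \<comment> \<open>\<open>\<nu>\<close> is only assumed subadditive, so two bounds add up to the
    factor 2; adding the distance to the limit later gives 3.\<close>
  have step: "vabs (s (Suc k) - s k) \<le> 2 * vabs \<pi> ^ k" for k
    using dist[of "s (Suc k)" "s k"] s[of k] s[of "Suc k"] uniformizer_power_le[of k "Suc k"] by simp
  have dec: "2 * vabs \<pi> ^ Suc k \<le> 2 * vabs \<pi> ^ k" for k using uniformizer_power_le[of k "Suc k"] by simp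
  have pow: "(\<lambda>k. vabs \<pi> ^ k) \<longlonglongrightarrow> 0"
    using vabs_uniformizer_pos vabs_uniformizer_less_1 by (intro LIMSEQ_realpow_zero) auto
  hence lim: "(\<lambda>k. 2 * vabs \<pi> ^ k) \<longlonglongrightarrow> 0" by (intro tendsto_mult_right_zero)
  obtain y where y: "\<And>k. vabs (y - s k) \<le> 2 * vabs \<pi> ^ k"
    using ultrametric_limit[OF step dec lim] by blast
  have sunit: "s k \<in> L" "vabs (s k) = 1" for k
  proof -
    have dig: "\<omega> k i \<in> unit_digits i" if "i \<le> k" for i using \<omega>(1)[of k] that by (auto simp: PiE_iff)
    show "s k \<in> L" unfolding s_def using dig by (rule expansion_L)
    have "s k = \<omega> k 0 + (\<Sum>i\<in>{1..k}. \<omega> k i * \<pi> ^ i)"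
      by (simp add: s_def expansion_def atMost_atLeast0 sum.atLeast_Suc_atMost)
    moreover have "vabs (\<Sum>i\<in>{1..k}. \<omega> k i * \<pi> ^ i) < 1"
    proof (rule vabs_sum_less)
      fix i assume i: "i \<in> {1..k}"
      hence "vabs (\<omega> k i * \<pi> ^ i) \<le> vabs \<pi> ^ i"
        using dig[of i] unit_digits_subset[of i] by (intro vabs_digit_mult_le) auto
      also have "\<dots> < vabs \<pi> ^ 0" using i by (intro uniformizer_power_less) simp
      finally show "vabs (\<omega> k i * \<pi> ^ i) < 1" by simp
    qed simp
    moreover have "vabs (\<omega> k 0) = 1" using dig[of 0] by (simp add: unit_digits_def)
    ultimately show "vabs (s k) = 1"
      using vabs_diff_eq_max[of "\<omega> k 0" 0 "- (\<Sum>i\<in>{1..k}. \<omega> k i * \<pi> ^ i)"] by simp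
  qed
  have small: "\<exists>k. 3 * vabs \<pi> ^ k < e" if e: "e > 0" for e
  proof -
    obtain k where "vabs \<pi> ^ k < e / 3"
      using real_arch_pow_inv[of "e / 3" "vabs \<pi>"] vabs_uniformizer_less_1 e by auto
    thus ?thesis by (intro exI[of _ k]) simp
  qed
  have "y \<in> L"
  proof (rule integer_ring_closed)
    fix e :: real assume "e > 0"
    then obtain k where k: "3 * vabs \<pi> ^ k < e" using small by blast
    have "vabs (y - s k) < e" using y[of k] k uniformizer_power_pos[of k] by linarith
    thus "\<exists>z\<in>integer_ring vabs L. vabs (y - z) < e"
      using sunit[of k] by (intro bexI[of _ "s k"]) (simp_all add: integer_ring_def)
  qed
  moreover have "vabs y = 1"
  proof -
    obtain k where k: "3 * vabs \<pi> ^ k < 1" using small[of 1] by auto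
    have "vabs (y - s k) < 1" using y[of k] k uniformizer_power_pos[of k] by linarith
    thus ?thesis using vabs_diff_eq_max[of y "s k" 0] sunit by simp
  qed
  moreover have "\<nu> [:- y, 1:] = 0"
  proof -
    have "\<nu> [:- y, 1:] \<le> 0 + e" if e: "e > 0" for e
    proof -
      obtain k where k: "3 * vabs \<pi> ^ k < e" using small[OF e] by blast
      have "\<nu> [:- y, 1:] \<le> \<nu> [:- s k, 1:] + vabs (s k - y)"
        using add[of "[:- s k, 1:]" "[:s k - y:]"] const[of "s k - y"] by simp
      thus ?thesis using s[of k] y[of k] vabs_minus_commute[of "s k" y] k by linarith
    qed
    hence "\<nu> [:- y, 1:] \<le> 0" by (rule field_le_epsilon)
    thus ?thesis using nonneg[of "[:- y, 1:]"] by linarith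
  qed
  ultimately show ?thesis
    using seminorm_eq_evaluation[OF \<nu>, of y] by (intro bexI[of _ y]) (simp_all add: mem_unit_group_iff)
qed

text \<open>Independent uniform digits. Summing the expansion carries this to the measure that gives
  all classes of a level the same mass.\<close>

definition digit_measure :: "(nat \<Rightarrow> 'k) measure" where
  "digit_measure = PiM UNIV (\<lambda>i. uniform_count_measure (unit_digits i))"

definition digit_limit :: "(nat \<Rightarrow> 'k) \<Rightarrow> 'k" where
  "digit_limit \<omega> = (SOME x. x \<in> unit_group vabs L \<and> (\<forall>k. vabs (x - expansion \<omega> k) \<le> vabs \<pi> ^ Suc k))"

definition haar :: "'k berk measure" where
  "haar = distr digit_measure (berk_borel vabs) (\<lambda>\<omega>. disc_point vabs (digit_limit \<omega>) 0)"

lemma space_digit_measure: "\<omega> \<in> space digit_measure \<longleftrightarrow> (\<forall>i. \<omega> i \<in> unit_digits i)"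
  by (auto simp: digit_measure_def space_PiM space_uniform_count_measure PiE_iff)

lemma digit_limit:
  assumes "\<omega> \<in> space digit_measure"
  shows "digit_limit \<omega> \<in> unit_group vabs L" "vabs (digit_limit \<omega> - expansion \<omega> k) \<le> vabs \<pi> ^ Suc k"
proof -
  have "\<exists>x. x \<in> unit_group vabs L \<and> (\<forall>k. vabs (x - expansion \<omega> k) \<le> vabs \<pi> ^ Suc k)"
    using expansion_converges[of \<omega>] assms unfolding space_digit_measure by blast
  from someI_ex[OF this] show "digit_limit \<omega> \<in> unit_group vabs L"
    "vabs (digit_limit \<omega> - expansion \<omega> k) \<le> vabs \<pi> ^ Suc k"
    unfolding digit_limit_def by blast+
qed

lemma unit_digits_nonempty: "unit_digits i \<noteq> {}"
proof -
  have "card (unit_digits i) > 0"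
    using q_ge_2 card_unit_digits_0 card_digits by (cases "i = 0") (auto simp: unit_digits_def)
  thus ?thesis by auto
qed

lemma product_prob_space_digits: "product_prob_space (\<lambda>i. uniform_count_measure (unit_digits i))"
proof -
  interpret prob_space "uniform_count_measure (unit_digits i)" for i
    by (rule prob_space_uniform_count_measure[OF finite_unit_digits unit_digits_nonempty])
  show ?thesis by unfold_locales
qed

lemma prob_space_digit_measure: "prob_space digit_measure"
  unfolding digit_measure_def
  by (intro prob_space_PiM prob_space_uniform_count_measure finite_unit_digits unit_digits_nonempty)

text \<open>Stated with singletons \<open>{d i}\<close> to have the product form of
  \<open>emeasure_PiM_Collect\<close>.\<close>

definition cylinder :: "nat \<Rightarrow> (nat \<Rightarrow> 'k) \<Rightarrow> (nat \<Rightarrow> 'k) set" where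
  "cylinder k d = {\<omega> \<in> space digit_measure. \<forall>i\<in>{..k}. \<omega> i \<in> {d i}}"

lemma cylinder_sets: "d \<in> digit_vectors k \<Longrightarrow> cylinder k d \<in> sets digit_measure"
  unfolding cylinder_def digit_measure_def
  by (intro sets.sets_Collect_finite_All measurable_sets_Collect[OF measurable_component_singleton])
     (auto simp: sets_uniform_count_measure PiE_iff)

lemma emeasure_cylinder:
  assumes d: "d \<in> digit_vectors k"
  shows "emeasure digit_measure (cylinder k d) = ennreal (class_mass k)"
proof -
  interpret product_prob_space "\<lambda>i. uniform_count_measure (unit_digits i)" UNIV
    by (rule product_prob_space_digits)
  have "emeasure digit_measure (cylinder k d) =
      (\<Prod>i\<le>k. emeasure (uniform_count_measure (unit_digits i)) {d i})"
    unfolding cylinder_def digit_measure_def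
    using d by (intro emeasure_PiM_Collect) (auto simp: sets_uniform_count_measure PiE_iff)
  also have "\<dots> = (\<Prod>i\<le>k. ennreal (1 / real (card (unit_digits i))))"
    using d by (intro prod.cong refl, subst emeasure_uniform_count_measure)
      (auto simp: finite_unit_digits PiE_iff)
  also have "\<dots> = ennreal (\<Prod>i\<le>k. 1 / real (card (unit_digits i)))" by (rule prod_ennreal) simp
  also have "(\<Prod>i\<le>k. 1 / real (card (unit_digits i))) = 1 / real (\<Prod>i\<le>k. card (unit_digits i))"
    by (simp add: prod_dividef)
  also have "(\<Prod>i\<le>k. card (unit_digits i)) = card (digit_vectors k)" by (simp add: card_PiE)
  finally show ?thesis by (simp add: class_mass_eq)
qed

text \<open>The tail after index \<open>k\<close> is smaller than the radius, so the class depends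
  on the first \<open>k + 1\<close> digits alone. Any point \<open>y\<close> of the class serves as
  centre, in particular another digit limit.\<close>

lemma digit_limit_near_iff:
  assumes \<omega>: "\<omega> \<in> space digit_measure" and d: "d \<in> digit_vectors k"
    and y: "vabs (y - expansion d k) < vabs \<pi> ^ k"
  shows "vabs (digit_limit \<omega> - y) < vabs \<pi> ^ k \<longleftrightarrow> \<omega> \<in> cylinder k d"
proof
  have lim: "vabs (digit_limit \<omega> - expansion \<omega> k) < vabs \<pi> ^ k"
    using digit_limit(2)[OF \<omega>, of k] uniformizer_power_less[of k "Suc k"] by simp
  {
    assume "vabs (digit_limit \<omega> - y) < vabs \<pi> ^ k"
    from vabs_add_less[OF this y] have "vabs (digit_limit \<omega> - expansion d k) < vabs \<pi> ^ k" by simp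
    from vabs_diff_less[OF this lim] have near: "vabs (expansion \<omega> k - expansion d k) < vabs \<pi> ^ k" by simp
    have "\<omega> i = d i" if "i \<le> k" for i
    proof (rule expansion_inject[OF _ _ near that])
      show "\<omega> i \<in> unit_digits i" for i using \<omega> by (simp add: space_digit_measure)
      show "d i \<in> unit_digits i" if "i \<le> k" for i using d that by (auto simp: PiE_iff)
    qed
    thus "\<omega> \<in> cylinder k d" using \<omega> by (simp add: cylinder_def)
  next
    assume "\<omega> \<in> cylinder k d"
    hence "expansion \<omega> k = expansion d k" by (intro expansion_cong) (simp add: cylinder_def)
    thus "vabs (digit_limit \<omega> - y) < vabs \<pi> ^ k" using vabs_diff_less[OF lim y] by simp
  }
qed

text \<open>The preimage of an open set is the union of the cylinders it contains, because a long
  enough cylinder maps into a small disc. With finitely many cylinders per level, the union is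
  countable.\<close>

lemma measurable_digit_point:
  "(\<lambda>\<omega>. disc_point vabs (digit_limit \<omega>) 0) \<in> measurable digit_measure (berk_borel vabs)"
  unfolding berk_borel_def
proof (rule measurable_measure_of)
  interpret Metric_space UNIV "\<lambda>x y. vabs (x - y)" by (rule Metric_space_vabs)
  let ?\<Phi> = "\<lambda>\<omega>. disc_point vabs (digit_limit \<omega>) 0"
  show "{U. openin (berk_P1 vabs) U} \<subseteq> Pow (topspace (berk_P1 vabs))" by (auto dest: openin_subset)
  show "?\<Phi> \<in> space digit_measure \<rightarrow> topspace (berk_P1 vabs)" by (auto intro: disc_point_in_P1)
  fix V assume "V \<in> {U. openin (berk_P1 vabs) U}"
  hence "openin (vtop vabs) {x \<in> topspace (vtop vabs). disc_point vabs x 0 \<in> V}"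
    using openin_continuous_map_preimage[OF continuous_disc_point] by blast
  hence V: "\<exists>r>0. \<forall>z. vabs (x - z) < r \<longrightarrow> disc_point vabs z 0 \<in> V" if "disc_point vabs x 0 \<in> V" for x
    using that unfolding vtop_def openin_mtopology by (auto simp: subset_iff)
  let ?P = "?\<Phi> -` V \<inter> space digit_measure"
  have "?P = (\<Union>k. \<Union>d\<in>{d \<in> digit_vectors k. cylinder k d \<subseteq> ?P}. cylinder k d)"
  proof (intro equalityI subsetI)
    fix \<omega> assume \<omega>: "\<omega> \<in> ?P"
    then obtain r where r: "r > 0" "\<And>z. vabs (digit_limit \<omega> - z) < r \<Longrightarrow> disc_point vabs z 0 \<in> V"
      using V[of "digit_limit \<omega>"] by auto
    obtain k where k: "vabs \<pi> ^ k < r" using real_arch_pow_inv[OF r(1) vabs_uniformizer_less_1] by blast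
    define d where "d = restrict \<omega> {..k}"
    have d: "d \<in> digit_vectors k" using \<omega> by (auto simp: d_def space_digit_measure)
    have exp: "expansion \<omega> k = expansion d k" by (rule expansion_cong) (simp add: d_def)
    have "vabs (digit_limit \<omega> - expansion d k) < vabs \<pi> ^ k"
      using digit_limit(2)[of \<omega> k] \<omega> uniformizer_power_less[of k "Suc k"] unfolding exp by simp
    note near = digit_limit_near_iff[OF _ d this]
    have "cylinder k d \<subseteq> ?P"
    proof
      fix \<omega>' assume \<omega>': "\<omega>' \<in> cylinder k d"
      hence sp: "\<omega>' \<in> space digit_measure" by (simp add: cylinder_def)
      have "vabs (digit_limit \<omega> - digit_limit \<omega>') < r"
        using near[OF sp] \<omega>' k vabs_minus_commute[of "digit_limit \<omega>" "digit_limit \<omega>'"] by simp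
      thus "\<omega>' \<in> ?P" using r(2) sp by simp
    qed
    moreover have "\<omega> \<in> cylinder k d" using \<omega> by (simp add: cylinder_def d_def)
    ultimately show "\<omega> \<in> (\<Union>k. \<Union>d\<in>{d \<in> digit_vectors k. cylinder k d \<subseteq> ?P}. cylinder k d)"
      using d by blast
  qed blast
  also have "\<dots> \<in> sets digit_measure"
    using finite_digit_vectors cylinder_sets
    by (intro sets.countable_UN sets.finite_UN) auto
  finally show "?P \<in> sets digit_measure" .
qed

lemma sets_haar: "sets haar = sets (berk_borel vabs)"
  by (simp add: haar_def)

lemma prob_space_haar: "prob_space haar"
  unfolding haar_def by (rule prob_space.prob_space_distr[OF prob_space_digit_measure measurable_digit_point])

lemma haar_residue_disc:
  assumes y: "y \<in> unit_group vabs L"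
  shows "emeasure haar (residue_disc y k) = ennreal (class_mass k)"
proof -
  obtain d where d: "d \<in> digit_vectors k" "vabs (y - expansion d k) < vabs \<pi> ^ k"
    using expansion_approximates_unit[OF y] by blast
  have "(\<lambda>\<omega>. disc_point vabs (digit_limit \<omega>) 0) -` residue_disc y k \<inter> space digit_measure = cylinder k d"
    using digit_limit_near_iff[OF _ d] cylinder_def[of k d]
    by (auto simp: disc_point_in_residue_disc_iff uniformizer_power_pos)
  thus ?thesis
    unfolding haar_def by (simp add: emeasure_distr measurable_digit_point residue_disc_sets emeasure_cylinder d)
qed

abbreviation unit_points :: "'k berk set" where
  "unit_points \<equiv> {disc_point vabs x 0 |x. x \<in> unit_group vabs L}"

text \<open>The Borel set used is the intersection over all levels of the finite unions of classes.
  Every digit limit lies in it, and by \<open>seminorm_in_all_classes\<close> it contains only unit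
  points.\<close>

lemma AE_haar: "AE \<zeta> in haar. \<zeta> \<in> unit_points"
proof -
  interpret prob_space haar by (rule prob_space_haar)
  let ?A = "\<Inter>k. \<Union>d\<in>digit_vectors k. residue_disc (expansion d k) k"
  have A: "?A \<in> sets (berk_borel vabs)"
    using residue_disc_sets finite_digit_vectors
    by (intro sets.countable_INT sets.finite_UN) auto
  have sub: "?A \<subseteq> unit_points"
  proof
    fix \<zeta> assume \<zeta>: "\<zeta> \<in> ?A"
    then obtain \<nu> where \<nu>: "\<zeta> = Some \<nu>" "\<nu> \<in> mult_seminorms vabs" by (auto simp: residue_disc_def)
    have "\<exists>\<omega>\<in>digit_vectors k. \<nu> [:- expansion \<omega> k, 1:] < vabs \<pi> ^ k" for k
      using \<zeta> \<nu>(1) by (auto simp: residue_disc_def)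
    then obtain y where "y \<in> unit_group vabs L" "\<nu> = D y 0" using seminorm_in_all_classes[OF \<nu>(2)] by blast
    thus "\<zeta> \<in> unit_points" using \<nu>(1) by (auto simp: disc_point_def)
  qed
  have "AE \<zeta> in haar. \<zeta> \<in> ?A"
    unfolding haar_def
  proof (subst AE_distr_iff[OF measurable_digit_point])
    have "{\<zeta> \<in> space (berk_borel vabs). \<zeta> \<in> ?A} = space (berk_borel vabs) \<inter> ?A" by blast
    thus "{\<zeta> \<in> space (berk_borel vabs). \<zeta> \<in> ?A} \<in> sets (berk_borel vabs)"
      using sets.Int[OF sets.top A] by simp
    show "AE \<omega> in digit_measure. disc_point vabs (digit_limit \<omega>) 0 \<in> ?A"
    proof (rule AE_I2, rule INT_I)
      fix \<omega> k assume \<omega>: "\<omega> \<in> space digit_measure"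
      obtain d where "d \<in> digit_vectors k" "vabs (digit_limit \<omega> - expansion d k) < vabs \<pi> ^ k"
        using expansion_approximates_unit[OF digit_limit(1)[OF \<omega>]] by blast
      thus "disc_point vabs (digit_limit \<omega>) 0 \<in> (\<Union>d\<in>digit_vectors k. residue_disc (expansion d k) k)"
        using uniformizer_power_pos[of k] by (auto simp: disc_point_in_residue_disc_iff)
    qed
  qed
  thus ?thesis by (rule eventually_mono) (rule subsetD[OF sub])
qed

section \<open>Geometric series and the Robin constants\<close>

lemma class_mass_sums: "(\<lambda>k. log_gap * class_mass k) sums (real q * log_gap / (real q - 1)\<^sup>2)"
proof -
  have q: "real q \<ge> 2" using q_ge_2 by simp
  have "(\<lambda>k. log_gap / (real q - 1) * (1 / real q) ^ k) sums (log_gap / (real q - 1) * (1 / (1 - 1 / real q)))"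
    using q by (intro sums_mult geometric_sums) auto
  moreover have "log_gap / (real q - 1) * (1 / (1 - 1 / real q)) = real q * log_gap / (real q - 1)\<^sup>2"
    using q by (simp add: field_simps power2_eq_square)
  moreover have "log_gap / (real q - 1) * (1 / real q) ^ k = log_gap * class_mass k" for k
    by (simp add: class_mass_def power_divide)
  ultimately show ?thesis by simp
qed

lemma sum_class_mass:
  "(\<Sum>k<N. log_gap * class_mass k) = (1 - 1 / real q ^ N) * (real q * log_gap / (real q - 1)\<^sup>2)"
proof -
  have q: "real q \<ge> 2" using q_ge_2 by simp
  have "(\<Sum>k<N. log_gap * class_mass k) = log_gap / (real q - 1) * (\<Sum>k<N. (1 / real q) ^ k)"
    by (simp add: class_mass_def sum_distrib_left power_divide)
  also have "(\<Sum>k<N. (1 / real q) ^ k) = (1 - 1 / real q ^ N) / (1 - 1 / real q)"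
    using q by (subst sum_gp_strict) (auto simp: power_divide)
  also have "log_gap / (real q - 1) * ((1 - 1 / real q ^ N) / (1 - 1 / real q)) =
      (1 - 1 / real q ^ N) * (log_gap / (real q - 1) * (1 / (1 - 1 / real q)))" by simp
  also have "log_gap / (real q - 1) * (1 / (1 - 1 / real q)) = real q * log_gap / (real q - 1)\<^sup>2"
    using q by (simp add: field_simps power2_eq_square)
  finally show ?thesis .
qed

text \<open>The potential is bounded at each unit separately: a random point falls into the level
  \<open>k\<close> class of a fixed unit with probability \<open>class_mass k\<close>, whatever the
  unit.\<close>

lemma energy_haar_le: "energy vabs haar \<le> ennreal (real q * log_gap / (real q - 1)\<^sup>2)"
proof -
  interpret prob_space haar by (rule prob_space_haar)
  have disc: "residue_disc y k \<in> sets haar" for y k by (simp add: sets_haar residue_disc_sets)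
  have pot: "(\<integral>\<^sup>+ \<xi>. neg_log (hsia vabs \<zeta> \<xi>) \<partial>haar) \<le> ennreal (real q * log_gap / (real q - 1)\<^sup>2)"
    if \<zeta>: "\<zeta> \<in> unit_points" for \<zeta>
  proof -
    obtain x where x: "x \<in> unit_group vabs L" "\<zeta> = disc_point vabs x 0" using \<zeta> by blast
    have "(\<integral>\<^sup>+ \<xi>. neg_log (hsia vabs \<zeta> \<xi>) \<partial>haar) \<le>
        (\<integral>\<^sup>+ \<xi>. (\<Sum>k. ennreal log_gap * indicator (residue_disc x k) \<xi>) \<partial>haar)"
    proof (rule nn_integral_mono_AE, rule AE_mp[OF AE_haar], intro AE_I2 impI)
      fix \<xi> assume "\<xi> \<in> unit_points"
      then obtain x' where x': "x' \<in> unit_group vabs L" "\<xi> = disc_point vabs x' 0" by blast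
      have "hsia vabs \<zeta> \<xi> = vabs (x' - x)"
        unfolding x(2) x'(2) using x(1) x'(1) vabs_minus_commute[of x x'] vabs_nonneg[of "x - x'"]
        by (subst hsia_disc_points) (auto simp: vabs_unit)
      moreover have "ennreal log_gap * indicator (residue_disc x k) \<xi> =
          ennreal (if vabs (x' - x) < vabs \<pi> ^ k then log_gap else 0)" for k
        unfolding x'(2) using uniformizer_power_pos[of k]
        by (auto simp: indicator_def disc_point_in_residue_disc_iff)
      ultimately show "neg_log (hsia vabs \<zeta> \<xi>) \<le> (\<Sum>k. ennreal log_gap * indicator (residue_disc x k) \<xi>)"
        using neg_log_le_sum_levels[of "x' - x"] by simp
    qed
    also have "\<dots> = (\<Sum>k. \<integral>\<^sup>+ \<xi>. ennreal log_gap * indicator (residue_disc x k) \<xi> \<partial>haar)"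
      using disc by (intro nn_integral_suminf borel_measurable_times_ennreal borel_measurable_indicator) auto
    also have "\<dots> = (\<Sum>k. ennreal log_gap * emeasure haar (residue_disc x k))"
      by (simp only: nn_integral_cmult_indicator[OF disc])
    also have "\<dots> = (\<Sum>k. ennreal (log_gap * class_mass k))"
      using log_gap_pos class_mass_nonneg by (simp add: haar_residue_disc[OF x(1)] ennreal_mult)
    also have "\<dots> = ennreal (real q * log_gap / (real q - 1)\<^sup>2)"
      using class_mass_sums log_gap_pos class_mass_nonneg by (intro suminf_ennreal_eq) auto
    finally show ?thesis .
  qed
  have "energy vabs haar \<le> (\<integral>\<^sup>+ \<zeta>. ennreal (real q * log_gap / (real q - 1)\<^sup>2) \<partial>haar)"
    unfolding energy_def
    by (rule nn_integral_mono_AE, rule AE_mp[OF AE_haar], intro AE_I2 impI pot)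
  thus ?thesis by (simp add: emeasure_space_1)
qed

lemma robin_units: "robin vabs unit_points = ereal (real q * log_gap / (real q - 1)\<^sup>2)"
proof (rule antisym)
  have c: "0 \<le> real q * log_gap / (real q - 1)\<^sup>2" using log_gap_pos by simp
  have "haar \<in> prob_measures_on vabs unit_points"
    using prob_space_haar sets_haar AE_haar by (simp add: prob_measures_on_def)
  hence "robin vabs unit_points \<le> enn2ereal (energy vabs haar)"
    unfolding robin_def by (rule INF_lower)
  also have "\<dots> \<le> enn2ereal (ennreal (real q * log_gap / (real q - 1)\<^sup>2))"
    using energy_haar_le by (simp add: less_eq_ennreal.rep_eq)
  finally show "robin vabs unit_points \<le> ereal (real q * log_gap / (real q - 1)\<^sup>2)"
    using c by simp
  show "ereal (real q * log_gap / (real q - 1)\<^sup>2) \<le> robin vabs unit_points"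
    unfolding robin_def
  proof (rule INF_greatest)
    fix \<nu> assume \<nu>: "\<nu> \<in> prob_measures_on vabs unit_points"
    \<comment> \<open>Unit points have radius 0, so the bound holds for every \<open>N\<close>;
      letting \<open>N\<close> grow gives the full series.\<close>
    have "ennreal (\<Sum>k<N. log_gap * class_mass k) \<le> energy vabs \<nu>" for N
      by (rule energy_lower_bound[OF \<nu>]) (use uniformizer_power_pos[of N] in \<open>force\<close>)
    moreover have "(\<lambda>N. ennreal (\<Sum>k<N. log_gap * class_mass k)) \<longlonglongrightarrow> ennreal (real q * log_gap / (real q - 1)\<^sup>2)"
      using class_mass_sums unfolding sums_def by (rule tendsto_ennrealI)
    ultimately have "ennreal (real q * log_gap / (real q - 1)\<^sup>2) \<le> energy vabs \<nu>"
      by (intro LIMSEQ_le_const2) auto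
    hence "enn2ereal (ennreal (real q * log_gap / (real q - 1)\<^sup>2)) \<le> enn2ereal (energy vabs \<nu>)"
      by (simp add: less_eq_ennreal.rep_eq)
    thus "ereal (real q * log_gap / (real q - 1)\<^sup>2) \<le> enn2ereal (energy vabs \<nu>)" using c by simp
  qed
qed

lemma robin_discs_ge:
  assumes "\<And>\<zeta>. \<zeta> \<in> E \<Longrightarrow> \<exists>x\<in>unit_group vabs L. \<exists>\<eta>. 0 \<le> \<eta> \<and> \<eta> \<le> vabs \<pi> ^ N \<and> \<zeta> = disc_point vabs x \<eta>"
  shows "ereal ((1 - 1 / real q ^ N) * (real q * log_gap / (real q - 1)\<^sup>2)) \<le> robin vabs E"
  unfolding robin_def
proof (rule INF_greatest)
  fix \<nu> assume \<nu>: "\<nu> \<in> prob_measures_on vabs E"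
  have "0 \<le> (\<Sum>k<N. log_gap * class_mass k)"
    using log_gap_pos class_mass_nonneg by (intro sum_nonneg) simp
  moreover have "enn2ereal (ennreal (\<Sum>k<N. log_gap * class_mass k)) \<le> enn2ereal (energy vabs \<nu>)"
    using energy_lower_bound[OF \<nu> assms] by (simp add: less_eq_ennreal.rep_eq)
  ultimately show "ereal ((1 - 1 / real q ^ N) * (real q * log_gap / (real q - 1)\<^sup>2)) \<le> enn2ereal (energy vabs \<nu>)"
    unfolding sum_class_mass by simp
qed

end

text \<open>For \<open>q = 2\<close> the correction vanishes and the inequality would read
  \<open>robin vabs F' \<ge> robin vabs Ox\<close>. This fails: moving the Haar mass from each
  \<open>x\<close> to the disc point of radius \<open>\<epsilon>\<close> about \<open>x\<close> caps
  the kernel at \<open>- ln \<epsilon>\<close> for close pairs and strictly lowers the energy. Hence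
  the restriction on the first conjunct, while the identity is asserted for every
  \<open>q\<close>.\<close>

theorem theorem11:
  fixes p q n :: nat
    and vabs :: "'k::{alg_closed_field, field_char_0} \<Rightarrow> real"
    and L :: "'k set" and \<pi> :: 'k and \<epsilon> :: real
    and Ox F' :: "'k berk set"
  assumes "padic_complex_field p vabs"
    and "finite_extension_Qp vabs L"
    and "uniformizer vabs L \<pi>"
    and "q = residue_field_order vabs L"
    and "n \<ge> 1"
    and "\<epsilon> > 0" and "vabs (\<pi> ^ (n + 1)) < \<epsilon>" and "\<epsilon> \<le> vabs (\<pi> ^ n)"
    and "Ox = {disc_point vabs x 0 |x. x \<in> unit_group vabs L}"
    and "F' = {\<zeta> \<in> topspace (berk_P1 vabs).
                 \<exists>x\<in>unit_group vabs L. \<exists>\<eta>. 0 \<le> \<eta> \<and> \<eta> \<le> \<epsilon> \<and> \<zeta> = disc_point vabs x \<eta>}"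
  shows "(q \<noteq> 2 \<longrightarrow> robin vabs F' \<ge> robin vabs Ox
            + ereal ((real q - 2) * ln (vabs \<pi>) / (real q ^ (n - 1) * (real q - 1)\<^sup>2))) \<and>
         robin vabs Ox
            + ereal ((real q - 2) * ln (vabs \<pi>) / (real q ^ (n - 1) * (real q - 1)\<^sup>2))
         = ereal (- (1 - (real q - 2) / real q ^ n) * (real q * ln (vabs \<pi>) / (real q - 1)\<^sup>2))"
proof -
  interpret padic_complex_field p vabs by (rule assms(1))
  interpret F: padic_local_field p vabs L \<pi>
    by unfold_locales (rule assms(2), rule assms(3))
  have q2: "2 \<le> q" using F.q_ge_2 assms(4) by simp
  define l where "l = - ln (vabs \<pi>)"
  have l: "F.log_gap = l" "l > 0" using F.log_gap_pos by (simp_all add: F.log_gap_def l_def)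
  define A where "A = real q * l / (real q - 1)\<^sup>2"
  have A: "A \<ge> 0" using l by (simp add: A_def)
  have Ox: "robin vabs Ox = ereal A"
    using F.robin_units assms(4,9) by (simp add: A_def l)
  \<comment> \<open>\<open>n \<ge> 1\<close> keeps \<open>n - 1\<close> from truncating; with this
    the correction becomes minus the fraction \<open>(q - 2) / q ^ n\<close> of
    \<open>A\<close>.\<close>
  have pow: "real q ^ n = real q * real q ^ (n - 1)" using assms(5) by (simp add: power_eq_if)
  have "(real q - 2) * ln (vabs \<pi>) / (real q ^ (n - 1) * (real q - 1)\<^sup>2) = - ((real q - 2) / real q ^ n * A)"
    using q2 by (simp add: A_def l_def pow)
  hence sum: "robin vabs Ox + ereal ((real q - 2) * ln (vabs \<pi>) / (real q ^ (n - 1) * (real q - 1)\<^sup>2))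
      = ereal ((1 - (real q - 2) / real q ^ n) * A)"
    unfolding Ox by (simp add: left_diff_distrib)
  have "ereal ((1 - (real q - 2) / real q ^ n) * A) \<le> robin vabs F'" if "q \<noteq> 2"
  proof -
    \<comment> \<open>Here \<open>q \<ge> 3\<close> enters: the loss \<open>1 / q ^ n\<close>
      obtained from \<open>N = n\<close> is weakened to the loss \<open>(q - 2) / q ^ n\<close> of
      the claim.\<close>
    have "real q - 2 \<ge> 1" using q2 that by linarith
    hence "1 / real q ^ n \<le> (real q - 2) / real q ^ n" by (intro divide_right_mono) auto
    hence "(1 - (real q - 2) / real q ^ n) * A \<le> (1 - 1 / real q ^ n) * A"
      using A by (intro mult_right_mono) auto
    moreover have "ereal ((1 - 1 / real q ^ n) * A) \<le> robin vabs F'"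
      unfolding A_def l(1)[symmetric] assms(4)
      by (rule F.robin_discs_ge) (use assms(8,10) in \<open>force simp: vabs_power\<close>)
    ultimately show ?thesis by (meson ereal_less_eq(3) order_trans)
  qed
  moreover have "A = - (real q * ln (vabs \<pi>) / (real q - 1)\<^sup>2)" by (simp add: A_def l_def)
  hence "(1 - (real q - 2) / real q ^ n) * A =
      - (1 - (real q - 2) / real q ^ n) * (real q * ln (vabs \<pi>) / (real q - 1)\<^sup>2)"
    by (simp only: minus_mult_commute)
  ultimately show ?thesis unfolding sum by simp
qed

end
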